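(* Let $X$ be an algebraic variety over $\mathbb F_q$ with zeta function $Z(X,T)$, and let $C=(\mathcal C,|\cdot|,W)$ be coloring data with weights in $R=\mathbb Z[[t_1,\dots,t_N]][t_1^{-1},\dots,t_N^{-1}]$. Let the exponents $v_{d,m}$ ($d\ge 1$, $m\in\mathbb Z^N$) be defined by the formal identity $$Z_C(\bullet,t,T)=\prod_{m\in\mathbb Z^N,\ d\ge 1}(1-t^mT^d)^{-v_{d,m}}.$$ Then the following identity holds in $R[[T]]$: $$Z_C(X,t,T)=\prod_{m\in\mathbb Z^N,\ d\ge 1}Z(X,t^mT^d)^{v_{d,m}}.$$
   Context: $\mathbb F_q$ is a finite field with $q$ elements, $\overline{\mathbb F}_q$ a fixed algebraic closure, and $\mathrm{Frob}_q: x\mapsto x^q$ the Frobenius automorphism, acting on $X(\overline{\mathbb F}_q)$. The zeta function of $X$ is $Z(X,T)=\exp\left(\sum_{r\ge1}N_r(X)\frac{T^r}{r}\right)$, where $N_r(X)=\#X(\mathbb F_{q^r})$. Coloring data $C=(\mathcal C,|\cdot|,W)$ consists of: a set $\mathcal C$ of colors; a degree function $|\cdot|:\mathcal C\to\mathbb Z_{\ge 0}$ such that there are finitely many colors of each degree and there is a unique color $0\in\mathcal C$ of degree $0$; and a weight function $W:\mathcal C\to R$ with $W(0)=1$, where $R=\mathbb Z[[t_1,\dots,t_N]][t_1^{-1},\dots,t_N^{-1}]$. For $f\in R$ and an integer $d\ge1$, $f(t^d)$ denotes the result of substituting $t_i\mapsto t_i^d$ for all $i$. For $m=(m_1,\dots,m_N)\in\mathbb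 Z^N$, $t^m=t_1^{m_1}\cdots t_N^{m_N}$. A coloring on $X$ is a map $\Lambda:X(\overline{\mathbb F}_q)\to\mathcal C$ with $\Lambda(x)=0$ for all but finitely many $x$; its degree is $|\Lambda|=\sum_{x\in X(\overline{\mathbb F}_q)}|\Lambda(x)|$. It is a coloring of $X/\mathbb F_q$ if $\Lambda(\mathrm{Frob}_q(x))=\Lambda(x)$ for all $x$. The weight of a coloring $\Lambda$ of $X/\mathbb F_q$ is $W(\Lambda)=\prod_{\{x\}}W(\Lambda(x))(t^{d(x)})$, the product running over the $\mathrm{Frob}_q$-orbits $\{x\}$ in $X(\overline{\mathbb F}_q)$, with $d(x)$ the size of the orbit of $x$. The coloring zeta function of $X$ is $Z_C(X,t,T)=\sum_\Lambda W(\Lambda)T^{|\Lambda|}\in R[[T]]$, the sum running over all colorings $\Lambda$ of $X/\mathbb F_q$. For $X=\bullet$ a point this is $Z_C(\bullet,t,T)=\sum_{\lambda\in\mathcal C}W(\lambda)T^{|\lambda|}\in 1+T\,R[[T]]$. The $v_{d,m}$ are integers, uniquely determined by $Z_C(\bullet,t,T)$, where it is understood that for each $d$ the series $\sum_{m}v_{d,m}t^m$ belongs to $R$ (so that the infinite products make sense formally). *)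

theory Defs
  imports
    "HOL-Algebra.Algebraic_Closure_Type"
    "HOL-Analysis.Finite_Cartesian_Product"
    "HOL-Library.Poly_Mapping"
    "HOL-Library.FuncSet"
begin

(* "$" is used for vectors *)
no_notation fps_nth (infixl "$" 75)

section \<open>The ring R of Laurent series in several variables\<close>

text \<open>
  An element of \<open>R = \<int>[[t\<^sub>1,\<dots>,t\<^sub>N]][t\<^sub>1\<^sup>-\<^sup>1,\<dots>,t\<^sub>N\<^sup>-\<^sup>1]\<close> is a family of integer coefficients indexed by
  \<open>\<int>\<^sup>N\<close> whose support lies in a translate of \<open>\<nat>\<^sup>N\<close>. The variables are indexed by the finite
  type \<open>'n\<close>, so \<open>N = CARD('n)\<close>.
\<close>

definition laurent_supp :: "(int ^ 'n \<Rightarrow> int) \<Rightarrow> bool"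
  where "laurent_supp f \<longleftrightarrow> (\<exists>b. \<forall>m. f m \<noteq> 0 \<longrightarrow> (\<forall>i. b \<le> m $ i))"

typedef (overloaded) 'n laurent = "{f :: int ^ 'n::finite \<Rightarrow> int. laurent_supp f}"
  morphisms lcoeff Abs_laurent
  by (rule exI[of _ "\<lambda>_. 0"]) (auto simp: laurent_supp_def)

setup_lifting type_definition_laurent

lemma laurent_eqI: "(\<And>m. lcoeff f m = lcoeff g m) \<Longrightarrow> f = g"
  by (metis ext lcoeff_inject)

lemma laurent_supp_lcoeff: "laurent_supp (lcoeff f)"
  using lcoeff by blast

lemma laurent_supp_add:
  assumes "laurent_supp f" "laurent_supp g"
  shows   "laurent_supp (\<lambda>m. f m + g m)"
proof -
  obtain b c where "\<And>m i. f m \<noteq> 0 \<Longrightarrow> b \<le> m $ i" "\<And>m i. g m \<noteq> 0 \<Longrightarrow> c \<le> m $ i"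
    using assms unfolding laurent_supp_def by metis
  then have "f m + g m \<noteq> 0 \<longrightarrow> (\<forall>i. min b c \<le> m $ i)" for m
    by (cases "f m = 0") (auto simp: min.coboundedI1 min.coboundedI2)
  then show ?thesis unfolding laurent_supp_def by blast
qed

lemma laurent_supp_uminus: "laurent_supp f \<Longrightarrow> laurent_supp (\<lambda>m. - f m)"
  by (simp add: laurent_supp_def)

lemma laurent_supp_mult:
  assumes "laurent_supp f" "laurent_supp g"
  shows   "laurent_supp (\<lambda>m. \<Sum>a | f a \<noteq> 0 \<and> g (m - a) \<noteq> 0. f a * g (m - a))"
proof -
  obtain b c where b: "\<And>m i. f m \<noteq> 0 \<Longrightarrow> b \<le> m $ i" and c: "\<And>m i. g m \<noteq> 0 \<Longrightarrow> c \<le> m $ i"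
    using assms unfolding laurent_supp_def by metis
  have "b + c \<le> m $ i"
    if "(\<Sum>a | f a \<noteq> 0 \<and> g (m - a) \<noteq> 0. f a * g (m - a)) \<noteq> 0" for m i
  proof -
    have "{a. f a \<noteq> 0 \<and> g (m - a) \<noteq> 0} \<noteq> {}" using that by (metis sum.empty)
    then obtain a where "f a \<noteq> 0" "g (m - a) \<noteq> 0" by blast
    with b[of a i] c[of "m - a" i] show ?thesis by simp
  qed
  then show ?thesis unfolding laurent_supp_def by blast
qed

lemma finite_int_box: "finite {a :: int ^ 'n::finite. \<forall>i. l \<le> a $ i \<and> a $ i \<le> u $ i}"
proof (rule finite_subset)
  show "{a. \<forall>i. l \<le> a $ i \<and> a $ i \<le> u $ i} \<subseteq> vec_lambda ` (PiE UNIV (\<lambda>i. {l..u $ i}))"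
  proof
    fix a :: "int ^ 'n" assume "a \<in> {a. \<forall>i. l \<le> a $ i \<and> a $ i \<le> u $ i}"
    then have "vec_nth a \<in> PiE UNIV (\<lambda>i. {l..u $ i})" by (auto simp: PiE_UNIV_domain)
    then show "a \<in> vec_lambda ` (PiE UNIV (\<lambda>i. {l..u $ i}))"
      by (metis image_eqI vec_nth_inverse)
  qed
qed (intro finite_imageI finite_PiE; simp)

lemma finite_laurent_conv:
  assumes "laurent_supp f" "laurent_supp g"
  shows   "finite {a. f a \<noteq> 0 \<and> g (m - a) \<noteq> 0}"
proof -
  obtain b c where b: "\<And>m i. f m \<noteq> 0 \<Longrightarrow> b \<le> m $ i" and c: "\<And>m i. g m \<noteq> 0 \<Longrightarrow> c \<le> m $ i"
    using assms unfolding laurent_supp_def by metis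
  have "{a. f a \<noteq> 0 \<and> g (m - a) \<noteq> 0}
          \<subseteq> {a. \<forall>i. b \<le> a $ i \<and> a $ i \<le> (\<chi> i. m $ i - c) $ i}"
  proof (clarsimp, intro conjI allI)
    fix a i assume a: "f a \<noteq> 0" "g (m - a) \<noteq> 0"
    show "b \<le> a $ i" by (rule b[OF a(1)])
    show "a $ i \<le> m $ i - c" using c[OF a(2), of i] by simp
  qed
  then show ?thesis by (rule finite_subset) (rule finite_int_box)
qed

instantiation laurent :: (finite) comm_ring_1
begin

lift_definition zero_laurent :: "'a laurent" is "\<lambda>_. 0"
  by (simp add: laurent_supp_def)

lift_definition one_laurent :: "'a laurent" is "\<lambda>m. if m = 0 then 1 else 0"
  by (auto simp: laurent_supp_def intro!: exI[of _ 0])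

lift_definition plus_laurent :: "'a laurent \<Rightarrow> 'a laurent \<Rightarrow> 'a laurent"
  is "\<lambda>f g m. f m + g m"
  by (rule laurent_supp_add)

lift_definition uminus_laurent :: "'a laurent \<Rightarrow> 'a laurent" is "\<lambda>f m. - f m"
  by (rule laurent_supp_uminus)

lift_definition minus_laurent :: "'a laurent \<Rightarrow> 'a laurent \<Rightarrow> 'a laurent"
  is "\<lambda>f g m. f m - g m"
  using laurent_supp_add laurent_supp_uminus by fastforce

text \<open>The set over which the Cauchy product is summed is finite.\<close>
lift_definition times_laurent :: "'a laurent \<Rightarrow> 'a laurent \<Rightarrow> 'a laurent"
  is "\<lambda>f g m. \<Sum>a | f a \<noteq> 0 \<and> g (m - a) \<noteq> 0. f a * g (m - a)"
  by (rule laurent_supp_mult)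

lemma lcoeff_times_superset:
  assumes "finite S" "{a. lcoeff f a \<noteq> 0 \<and> lcoeff g (m - a) \<noteq> 0} \<subseteq> S"
  shows   "lcoeff (f * g :: 'a laurent) m = (\<Sum>a\<in>S. lcoeff f a * lcoeff g (m - a))"
  unfolding times_laurent.rep_eq using assms by (intro sum.mono_neutral_left) auto

lemma laurent_times_commute: "f * g = g * (f :: 'a laurent)"
proof (rule laurent_eqI)
  fix m
  show "lcoeff (f * g) m = lcoeff (g * f) m"
    unfolding times_laurent.rep_eq
    by (rule sum.reindex_bij_witness[of _ "\<lambda>a. m - a" "\<lambda>a. m - a"]) (auto simp: mult.commute)
qed

lemma laurent_times_assoc: "(f * g) * h = f * (g * h :: 'a laurent)"
proof (rule laurent_eqI)
  fix m
  define F G H where "F = lcoeff f" and "G = lcoeff g" and "H = lcoeff h"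
  have supp: "laurent_supp F" "laurent_supp G" "laurent_supp H"
    by (simp_all add: F_def G_def H_def laurent_supp_lcoeff)
  have suppGH: "laurent_supp (lcoeff (g * h))" and suppFG: "laurent_supp (lcoeff (f * g))"
    by (rule laurent_supp_lcoeff)+
  define A where "A = {a. lcoeff (f * g) a \<noteq> 0 \<and> H (m - a) \<noteq> 0}"
  define B where "B = (\<lambda>a. {b. F b \<noteq> 0 \<and> G (a - b) \<noteq> 0})"
  define A' where "A' = {b. F b \<noteq> 0 \<and> lcoeff (g * h) (m - b) \<noteq> 0}"
  define T where "T = {(a, b). F b \<noteq> 0 \<and> G (a - b) \<noteq> 0 \<and> H (m - a) \<noteq> 0}"
  obtain kf kg kh where k: "\<And>m i. F m \<noteq> 0 \<Longrightarrow> kf \<le> m $ i" "\<And>m i. G m \<noteq> 0 \<Longrightarrow> kg \<le> m $ i"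
      "\<And>m i. H m \<noteq> 0 \<Longrightarrow> kh \<le> m $ i"
    using supp unfolding laurent_supp_def by metis
  have finT: "finite T"
  proof (rule finite_subset)
    show "T \<subseteq> {a. \<forall>i. kf + kg \<le> a $ i \<and> a $ i \<le> (\<chi> i. m $ i - kh) $ i}
            \<times> {b. \<forall>i. kf \<le> b $ i \<and> b $ i \<le> (\<chi> i. m $ i - kh - kg) $ i}"
    proof (clarsimp simp: T_def, intro conjI allI)
      fix a b i assume *: "F b \<noteq> 0" "G (a - b) \<noteq> 0" "H (m - a) \<noteq> 0"
      show "kf + kg \<le> a $ i" "a $ i \<le> m $ i - kh" "kf \<le> b $ i" "b $ i \<le> m $ i - kh - kg"
        using k(1)[OF *(1), of i] k(2)[OF *(2), of i] k(3)[OF *(3), of i] by simp_all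
    qed
  qed (intro finite_cartesian_product finite_int_box)
  have finB: "finite (B a)" for a
    unfolding B_def by (rule finite_laurent_conv) fact+
  have "lcoeff (f * g * h) m = (\<Sum>a\<in>fst ` T. lcoeff (f * g) a * H (m - a))"
    unfolding H_def
  proof (rule lcoeff_times_superset)
    show "{a. lcoeff (f * g) a \<noteq> 0 \<and> lcoeff h (m - a) \<noteq> 0} \<subseteq> fst ` T"
    proof safe
      fix a assume a: "lcoeff (f * g) a \<noteq> 0" "lcoeff h (m - a) \<noteq> 0"
      have "{b. F b \<noteq> 0 \<and> G (a - b) \<noteq> 0} \<noteq> {}"
        using a(1) unfolding times_laurent.rep_eq F_def G_def by (metis sum.empty)
      then obtain b where "F b \<noteq> 0" "G (a - b) \<noteq> 0" by blast
      with a(2) have "(a, b) \<in> T" by (simp add: T_def H_def)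
      then show "a \<in> fst ` T" by force
    qed
  qed (use finT in simp)
  also have "\<dots> = (\<Sum>a\<in>fst ` T. \<Sum>b\<in>B a. F b * G (a - b) * H (m - a))"
    unfolding times_laurent.rep_eq B_def F_def G_def by (simp add: sum_distrib_right)
  also have "\<dots> = (\<Sum>(a,b)\<in>(SIGMA a:fst ` T. B a). F b * G (a - b) * H (m - a))"
    using finT finB by (intro sum.Sigma) auto
  also have "\<dots> = (\<Sum>(a,b)\<in>T. F b * G (a - b) * H (m - a))"
    using finT finB
    by (intro sum.mono_neutral_right) (auto simp: T_def B_def image_iff intro!: finite_SigmaI)
  finally have 1: "lcoeff (f * g * h) m = (\<Sum>(a,b)\<in>T. F b * G (a - b) * H (m - a))" .
  have "lcoeff (f * (g * h)) m = (\<Sum>b\<in>snd ` T. F b * lcoeff (g * h) (m - b))"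
    unfolding F_def
  proof (rule lcoeff_times_superset)
    show "{b. lcoeff f b \<noteq> 0 \<and> lcoeff (g * h) (m - b) \<noteq> 0} \<subseteq> snd ` T"
    proof safe
      fix b assume a: "lcoeff f b \<noteq> 0" "lcoeff (g * h) (m - b) \<noteq> 0"
      have "{c. G c \<noteq> 0 \<and> H (m - b - c) \<noteq> 0} \<noteq> {}"
        using a(2) unfolding times_laurent.rep_eq H_def G_def by (metis sum.empty)
      then obtain c where "G c \<noteq> 0" "H (m - b - c) \<noteq> 0" by blast
      with a(1) have "(b + c, b) \<in> T" by (simp add: T_def F_def algebra_simps)
      then show "b \<in> snd ` T" by force
    qed
  qed (use finT in simp)
  also have "\<dots> = (\<Sum>b\<in>snd ` T. \<Sum>c | G c \<noteq> 0 \<and> H (m - b - c) \<noteq> 0. F b * G c * H (m - b - c))"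
    unfolding times_laurent.rep_eq H_def G_def by (simp add: sum_distrib_left mult.assoc)
  also have "\<dots> = (\<Sum>(b,c)\<in>(SIGMA b:snd ` T. {c. G c \<noteq> 0 \<and> H (m - b - c) \<noteq> 0}).
                      F b * G c * H (m - b - c))"
    using finT finite_laurent_conv[OF supp(2,3)] by (intro sum.Sigma) auto
  also have "\<dots> = (\<Sum>(b,c)\<in>(\<lambda>(a,b). (b, a - b)) ` T. F b * G c * H (m - b - c))"
  proof (rule sum.mono_neutral_right)
    show "finite (SIGMA b:snd ` T. {c. G c \<noteq> 0 \<and> H (m - b - c) \<noteq> 0})"
      using finT finite_laurent_conv[OF supp(2,3)] by (intro finite_SigmaI) auto
    show "(\<lambda>(a,b). (b, a - b)) ` T \<subseteq> (SIGMA b:snd ` T. {c. G c \<noteq> 0 \<and> H (m - b - c) \<noteq> 0})"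
      by (force simp: T_def)
    have "(b, c) \<in> (\<lambda>(a,b). (b, a - b)) ` T" if "F b \<noteq> 0" "G c \<noteq> 0" "H (m - b - c) \<noteq> 0" for b c
      using that by (intro image_eqI[of _ _ "(b + c, b)"]) (auto simp: T_def algebra_simps)
    then show "\<forall>x\<in>(SIGMA b:snd ` T. {c. G c \<noteq> 0 \<and> H (m - b - c) \<noteq> 0}) - (\<lambda>(a,b). (b, a - b)) ` T.
        (case x of (b, c) \<Rightarrow> F b * G c * H (m - b - c)) = 0"
      by (auto simp del: mult_eq_0_iff) fastforce
  qed
  also have "\<dots> = (\<Sum>(a,b)\<in>T. F b * G (a - b) * H (m - a))"
    by (subst sum.reindex) (auto simp: inj_on_def case_prod_unfold)
  finally show "lcoeff (f * g * h) m = lcoeff (f * (g * h)) m" using 1 by simp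
qed

lemma laurent_distrib_right: "(f + g) * h = f * h + g * (h :: 'a laurent)"
proof (rule laurent_eqI)
  fix m
  define S where "S = {a. lcoeff f a \<noteq> 0 \<and> lcoeff h (m - a) \<noteq> 0} \<union>
                      {a. lcoeff g a \<noteq> 0 \<and> lcoeff h (m - a) \<noteq> 0}"
  have S: "finite S"
    unfolding S_def by (intro finite_UnI finite_laurent_conv laurent_supp_lcoeff)
  have "lcoeff ((f + g) * h) m = (\<Sum>a\<in>S. lcoeff (f + g) a * lcoeff h (m - a))"
    by (rule lcoeff_times_superset[OF S]) (auto simp: S_def plus_laurent.rep_eq)
  moreover have "lcoeff (f * h) m = (\<Sum>a\<in>S. lcoeff f a * lcoeff h (m - a))"
    by (rule lcoeff_times_superset[OF S]) (auto simp: S_def)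
  moreover have "lcoeff (g * h) m = (\<Sum>a\<in>S. lcoeff g a * lcoeff h (m - a))"
    by (rule lcoeff_times_superset[OF S]) (auto simp: S_def)
  ultimately show "lcoeff ((f + g) * h) m = lcoeff (f * h + g * h) m"
    by (simp add: plus_laurent.rep_eq distrib_right sum.distrib)
qed

lemma laurent_one_times: "1 * f = (f :: 'a laurent)"
proof (rule laurent_eqI)
  fix m
  have "lcoeff (1 * f) m = (\<Sum>a\<in>{0}. lcoeff 1 a * lcoeff f (m - a))"
    by (rule lcoeff_times_superset) (auto simp: one_laurent.rep_eq split: if_splits)
  then show "lcoeff (1 * f) m = lcoeff f m" by (simp add: one_laurent.rep_eq)
qed

instance
proof
  fix a b c :: "'a laurent"
  show "a + b + c = a + (b + c)" by transfer (simp add: add.assoc)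
  show "a + b = b + a" by transfer (simp add: add.commute)
  show "0 + a = a" by transfer simp
  show "- a + a = 0" by transfer simp
  show "a - b = a + - b" by transfer simp
  show "a * b * c = a * (b * c)" by (rule laurent_times_assoc)
  show "a * b = b * a" by (rule laurent_times_commute)
  show "1 * a = a" by (rule laurent_one_times)
  show "(a + b) * c = a * c + b * c" by (rule laurent_distrib_right)
  show "(0 :: 'a laurent) \<noteq> 1" by transfer (metis zero_neq_one)
qed

end

text \<open>The monomial \<open>t\<^sup>m\<close>.\<close>
lift_definition lmonom :: "int ^ 'n::finite \<Rightarrow> 'n laurent" is "\<lambda>m k. if k = m then 1 else 0"
proof -
  fix m :: "int ^ 'n"
  show "laurent_supp (\<lambda>k. if k = m then 1 else 0)"
    unfolding laurent_supp_def
    by (rule exI[of _ "Min (range (($) m))"]) (auto split: if_splits)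
qed

text \<open>\<open>f(t\<^sup>d)\<close>, used only for \<open>d \<ge> 1\<close>: the coefficient of \<open>t\<^sup>m\<close> in \<open>f\<close> becomes that of \<open>t\<^sup>d\<^sup>m\<close>.\<close>
lift_definition lsubst_pow :: "nat \<Rightarrow> 'n::finite laurent \<Rightarrow> 'n laurent"
  is "\<lambda>d f m. if \<forall>i. int d dvd m $ i then f (\<chi> i. m $ i div int d) else 0"
proof -
  fix d :: nat and f :: "int ^ 'n \<Rightarrow> int" assume "laurent_supp f"
  then obtain b where b: "\<And>m i. f m \<noteq> 0 \<Longrightarrow> b \<le> m $ i" unfolding laurent_supp_def by metis
  have "int d * b \<le> m $ i"
    if "\<forall>i. int d dvd m $ i" "f (\<chi> i. m $ i div int d) \<noteq> 0" for m i
  proof -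
    have "b \<le> m $ i div int d" using b[OF that(2), of i] by simp
    then have "int d * b \<le> int d * (m $ i div int d)" by (simp add: mult_left_mono)
    then show ?thesis using that(1) by simp
  qed
  then show "laurent_supp (\<lambda>m. if \<forall>i. int d dvd m $ i then f (\<chi> i. m $ i div int d) else 0)"
    unfolding laurent_supp_def by (intro exI[of _ "int d * b"]) (simp split: if_splits)
qed

section \<open>Power series over R\<close>

definition of_int_fps :: "int fps \<Rightarrow> 'a::ring_1 fps"
  where "of_int_fps f = Abs_fps (\<lambda>n. of_int (fps_nth f n))"

text \<open>Integer powers of series with constant term \<open>1\<close>.\<close>
definition fps_zpow :: "'a::comm_ring_1 fps \<Rightarrow> int \<Rightarrow> 'a fps"
  where "fps_zpow f k = (if k \<ge> 0 then f ^ nat k else fps_right_inverse f 1 ^ nat (- k))"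

text \<open>\<open>t\<^sup>m T\<^sup>d\<close>\<close>
definition tT :: "nat \<Rightarrow> int ^ 'n::finite \<Rightarrow> 'n laurent fps"
  where "tT d m = fps_const (lmonom m) * fps_X ^ d"

text \<open>
  Unconditional convergence of an infinite product in \<open>R[[T]]\<close>: every coefficient of \<open>T\<^sup>k t\<^sup>m\<close> is
  the same for all sufficiently large finite partial products.
\<close>
definition has_formal_prod :: "('i \<Rightarrow> 'n::finite laurent fps) \<Rightarrow> 'i set \<Rightarrow> 'n laurent fps \<Rightarrow> bool"
  where "has_formal_prod f I P \<longleftrightarrow>
    (\<forall>k m. \<forall>\<^sub>F S in finite_subsets_at_top I.
       lcoeff (fps_nth (\<Prod>i\<in>S. f i) k) m = lcoeff (fps_nth P k) m)"

section \<open>Algebraic varieties over a finite field\<close>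

text \<open>
  The type \<open>'k\<close> is the finite field with \<open>q = CARD('k)\<close> elements and \<open>'k alg_closure\<close> its algebraic
  closure. Polynomials have coefficients in \<open>'k\<close>, so the topology below is the Zariski topology
  given by equations over \<open>'k\<close>. A point of affine \<open>n\<close>-space is a sequence vanishing from index \<open>n\<close>
  on; variables of index at least \<open>n\<close> therefore vanish on it and need not be excluded.
\<close>

type_synonym 'k mpoly = "(nat \<Rightarrow>\<^sub>0 nat) \<Rightarrow>\<^sub>0 'k"

definition mpeval :: "'k::field mpoly \<Rightarrow> (nat \<Rightarrow> 'k alg_closure) \<Rightarrow> 'k alg_closure"
  where "mpeval f x = (\<Sum>m\<in>Poly_Mapping.keys f.
    to_ac (Poly_Mapping.lookup f m) *
      (\<Prod>i\<in>Poly_Mapping.keys m. x i ^ Poly_Mapping.lookup m i))"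

definition affine_space :: "nat \<Rightarrow> (nat \<Rightarrow> 'k::field alg_closure) set"
  where "affine_space n = {x. \<forall>i\<ge>n. x i = 0}"

definition zero_locus :: "'k::field mpoly set \<Rightarrow> (nat \<Rightarrow> 'k alg_closure) set"
  where "zero_locus S = {x. \<forall>f\<in>S. mpeval f x = 0}"

definition zariski_closed_in ::
    "(nat \<Rightarrow> 'k::field alg_closure) set \<Rightarrow> (nat \<Rightarrow> 'k alg_closure) set \<Rightarrow> bool"
  where "zariski_closed_in D Z \<longleftrightarrow> (\<exists>S. Z = D \<inter> zero_locus S)"

definition zariski_open_in ::
    "(nat \<Rightarrow> 'k::field alg_closure) set \<Rightarrow> (nat \<Rightarrow> 'k alg_closure) set \<Rightarrow> bool"
  where "zariski_open_in D U \<longleftrightarrow> (\<exists>S. U = D - zero_locus S)"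

definition regular_fun ::
    "(nat \<Rightarrow> 'k::field alg_closure) set \<Rightarrow> ((nat \<Rightarrow> 'k alg_closure) \<Rightarrow> 'k alg_closure) \<Rightarrow> bool"
  where "regular_fun D f \<longleftrightarrow>
    (\<forall>x\<in>D. \<exists>U a b. zariski_open_in D U \<and> x \<in> U \<and>
       (\<forall>y\<in>U. mpeval b y \<noteq> 0 \<and> f y = mpeval a y / mpeval b y))"

definition join_coords ::
    "nat \<Rightarrow> (nat \<Rightarrow> 'a) \<Rightarrow> (nat \<Rightarrow> 'a) \<Rightarrow> nat \<Rightarrow> 'a"
  where "join_coords n x y = (\<lambda>i. if i < n then x i else y (i - n))"

text \<open>
  A variety is given by the set of its points over the algebraic closure together with a finite
  atlas: the \<open>i\<close>-th chart maps \<open>chart_dom V i\<close> bijectively onto an affine algebraic set in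
  \<open>chart_dim V i\<close>-space. Everything is defined over \<open>'k\<close>: equations of the charts, overlaps,
  transition maps, and the (closed) diagonal. Equivalently, this is a reduced separated scheme of
  finite type over \<open>'k\<close> with a chosen finite affine cover; irreducibility is not required.
\<close>

record (overloaded) ('k::field, 'p) atlas =
  points :: "'p set"
  ncharts :: nat
  chart_dom :: "nat \<Rightarrow> 'p set"
  chart_dim :: "nat \<Rightarrow> nat"
  coord :: "nat \<Rightarrow> 'p \<Rightarrow> nat \<Rightarrow> 'k alg_closure"

definition transition ::
    "('k::field, 'p) atlas \<Rightarrow> nat \<Rightarrow> nat \<Rightarrow> (nat \<Rightarrow> 'k alg_closure) \<Rightarrow> nat \<Rightarrow> 'k alg_closure"
  where "transition V i j x = coord V j (inv_into (chart_dom V i) (coord V i) x)"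

definition variety :: "('k::field, 'p) atlas \<Rightarrow> bool"
  where "variety V \<longleftrightarrow>
    points V = (\<Union>i<ncharts V. chart_dom V i) \<and>
    (\<forall>i<ncharts V.
       inj_on (coord V i) (chart_dom V i) \<and>
       zariski_closed_in (affine_space (chart_dim V i)) (coord V i ` chart_dom V i)) \<and>
    (\<forall>i<ncharts V. \<forall>j<ncharts V.
       zariski_open_in (coord V i ` chart_dom V i) (coord V i ` (chart_dom V i \<inter> chart_dom V j)) \<and>
       (\<forall>k<chart_dim V j.
          regular_fun (coord V i ` (chart_dom V i \<inter> chart_dom V j)) (\<lambda>x. transition V i j x k)) \<and>
       zariski_closed_in (affine_space (chart_dim V i + chart_dim V j))
         ((\<lambda>p. join_coords (chart_dim V i) (coord V i p) (coord V j p)) `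
            (chart_dom V i \<inter> chart_dom V j)))"

text \<open>\<open>Frob\<^sub>q\<close> raises the coordinates in each chart to the \<open>q\<close>-th power.\<close>
definition frob :: "('k::finite_field, 'p) atlas \<Rightarrow> 'p \<Rightarrow> 'p"
  where "frob V p = (THE p'. p' \<in> points V \<and>
    (\<forall>i<ncharts V. p \<in> chart_dom V i \<longrightarrow>
       p' \<in> chart_dom V i \<and> coord V i p' = (\<lambda>k. coord V i p k ^ CARD('k))))"

text \<open>The subfield with \<open>q\<^sup>r\<close> elements of the algebraic closure.\<close>
definition subfield_pow :: "nat \<Rightarrow> 'k::finite_field alg_closure set"
  where "subfield_pow r = {a. a ^ (CARD('k) ^ r) = a}"

definition rational_points :: "('k::finite_field, 'p) atlas \<Rightarrow> nat \<Rightarrow> 'p set"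
  where "rational_points V r =
    {p \<in> points V. \<exists>i<ncharts V. p \<in> chart_dom V i \<and> (\<forall>k. coord V i p k \<in> subfield_pow r)}"

definition zeta :: "('k::finite_field, 'p) atlas \<Rightarrow> rat fps"
  where "zeta V = fps_compose (fps_exp 1)
    (Abs_fps (\<lambda>r. if r = 0 then 0 else of_nat (card (rational_points V r)) / of_nat r))"

definition point_variety :: "('k::field, unit) atlas"
  where "point_variety = \<lparr>points = {()}, ncharts = 1, chart_dom = (\<lambda>_. {()}),
    chart_dim = (\<lambda>_. 0), coord = (\<lambda>_ _ _. 0)\<rparr>"

section \<open>Colorings\<close>

text \<open>The set of colors is the type \<open>'c\<close>.\<close>
record ('c, 'n::finite) coloring_data =
  cdeg :: "'c \<Rightarrow> nat"
  zero_color :: 'c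
  weight :: "'c \<Rightarrow> 'n laurent"

definition valid_coloring_data :: "('c, 'n::finite) coloring_data \<Rightarrow> bool"
  where "valid_coloring_data C \<longleftrightarrow>
    (\<forall>n. finite {c. cdeg C c = n}) \<and> {c. cdeg C c = 0} = {zero_color C} \<and>
    weight C (zero_color C) = 1"

definition csupp :: "('k::field, 'p) atlas \<Rightarrow> ('c, 'n::finite) coloring_data \<Rightarrow> ('p \<Rightarrow> 'c) \<Rightarrow> 'p set"
  where "csupp V C \<Lambda> = {x \<in> points V. \<Lambda> x \<noteq> zero_color C}"

text \<open>Colorings of \<open>V\<close> defined over \<open>'k\<close>, as functions on \<open>points V\<close> (hence \<open>extensional\<close>).\<close>
definition colorings ::
    "('k::finite_field, 'p) atlas \<Rightarrow> ('c, 'n::finite) coloring_data \<Rightarrow> ('p \<Rightarrow> 'c) set"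
  where "colorings V C = {\<Lambda> \<in> extensional (points V). finite (csupp V C \<Lambda>) \<and>
    (\<forall>x\<in>points V. \<Lambda> (frob V x) = \<Lambda> x)}"

text \<open>Points outside the support have color \<open>0\<close>, hence degree \<open>0\<close>.\<close>
definition coloring_degree ::
    "('k::field, 'p) atlas \<Rightarrow> ('c, 'n::finite) coloring_data \<Rightarrow> ('p \<Rightarrow> 'c) \<Rightarrow> nat"
  where "coloring_degree V C \<Lambda> = (\<Sum>x\<in>csupp V C \<Lambda>. cdeg C (\<Lambda> x))"

definition frob_orbit :: "('k::finite_field, 'p) atlas \<Rightarrow> 'p \<Rightarrow> 'p set"
  where "frob_orbit V x = range (\<lambda>k. (frob V ^^ k) x)"

text \<open>Orbits outside the support contribute the factor \<open>W(0)(t\<^sup>d) = 1\<close>.\<close>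
definition coloring_weight ::
    "('k::finite_field, 'p) atlas \<Rightarrow> ('c, 'n::finite) coloring_data \<Rightarrow> ('p \<Rightarrow> 'c) \<Rightarrow> 'n laurent"
  where "coloring_weight V C \<Lambda> =
    (\<Prod>B\<in>frob_orbit V ` csupp V C \<Lambda>. lsubst_pow (card B) (weight C (the_elem (\<Lambda> ` B))))"

definition coloring_zeta ::
    "('k::finite_field, 'p) atlas \<Rightarrow> ('c, 'n::finite) coloring_data \<Rightarrow> 'n laurent fps"
  where "coloring_zeta V C = Abs_fps (\<lambda>n.
    \<Sum>\<Lambda> | \<Lambda> \<in> colorings V C \<and> coloring_degree V C \<Lambda> = n. coloring_weight V C \<Lambda>)"

text \<open>Consistency checks for the one-point variety.\<close>

lemma variety_point: "variety (point_variety :: ('k::field, unit) atlas)"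
proof -
  have eval: "mpeval 1 x = 1" for x :: "nat \<Rightarrow> 'k alg_closure"
    by (simp add: mpeval_def one_poly_mapping.rep_eq keys_one)
  have zero: "mpeval 0 x = 0" for x :: "nat \<Rightarrow> 'k alg_closure"
    by (simp add: mpeval_def)
  have aff: "affine_space 0 = {\<lambda>_. 0 :: 'k alg_closure}"
    by (auto simp: affine_space_def)
  have opn: "zariski_open_in D D" for D :: "(nat \<Rightarrow> 'k alg_closure) set"
    unfolding zariski_open_in_def zero_locus_def by (rule exI[of _ "{1}"]) (simp add: eval)
  have cls: "zariski_closed_in D D" for D :: "(nat \<Rightarrow> 'k alg_closure) set"
    unfolding zariski_closed_in_def zero_locus_def by (rule exI[of _ "{}"]) simp
  have reg: "regular_fun D (\<lambda>_. 0)" for D :: "(nat \<Rightarrow> 'k alg_closure) set"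
    unfolding regular_fun_def
    by (intro ballI exI[of _ D] exI[of _ 0] exI[of _ 1]) (simp add: opn eval zero)
  have join: "join_coords 0 (\<lambda>_. 0) (\<lambda>_. 0 :: 'k alg_closure) = (\<lambda>_. 0)"
    by (simp add: join_coords_def fun_eq_iff)
  show ?thesis
    using cls[of "{\<lambda>_. 0}"] opn[of "{\<lambda>_. 0}"] reg
    by (simp add: variety_def point_variety_def aff join lessThan_Suc)
qed

lemma coloring_zeta_point:
  fixes C :: "('c, 'n::finite) coloring_data"
  assumes "valid_coloring_data C"
  shows "coloring_zeta (point_variety :: ('k::finite_field, unit) atlas) C =
           Abs_fps (\<lambda>n. \<Sum>c | cdeg C c = n. weight C c)"
proof -
  let ?P = "point_variety :: ('k, unit) atlas"
  have subst1: "lsubst_pow 1 f = f" for f :: "'n laurent"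
    by (rule laurent_eqI) (simp add: lsubst_pow.rep_eq)
  have orb: "frob_orbit ?P x = {()}" for x
    by (auto simp: frob_orbit_def)
  have col: "\<Lambda> \<in> colorings ?P C" for \<Lambda> :: "unit \<Rightarrow> 'c"
    by (auto simp: colorings_def point_variety_def extensional_def csupp_def)
  have supp: "csupp ?P C \<Lambda> = (if \<Lambda> () = zero_color C then {} else {()})" for \<Lambda>
    by (auto simp: csupp_def point_variety_def)
  have z: "cdeg C (zero_color C) = 0" "weight C (zero_color C) = 1"
    using assms by (auto simp: valid_coloring_data_def)
  have deg: "coloring_degree ?P C \<Lambda> = cdeg C (\<Lambda> ())" for \<Lambda>
    by (simp add: coloring_degree_def supp z)
  have wt: "coloring_weight ?P C \<Lambda> = weight C (\<Lambda> ())" for \<Lambda>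
    by (simp add: coloring_weight_def supp orb z subst1[simplified])
  have "(\<Sum>\<Lambda> | \<Lambda> \<in> colorings ?P C \<and> coloring_degree ?P C \<Lambda> = n. coloring_weight ?P C \<Lambda>) =
        (\<Sum>c | cdeg C c = n. weight C c)" for n
    by (rule sum.reindex_bij_witness[of _ "\<lambda>c _. c" "\<lambda>\<Lambda>. \<Lambda> ()"]) (auto simp: col deg wt)
  then show ?thesis by (simp add: coloring_zeta_def)
qed

end

theory Submission
  imports Defs
begin

text \<open>
  Let \<open>P(t, T)\<close> be the coloring zeta function of a point. A coloring over the base field is constant
  on Frobenius orbits, so choosing it means choosing a color for each closed point; an orbit \<open>B\<close> of
  color \<open>\<lambda>\<close> contributes the weight \<open>W(\<lambda>)(t\<^sup>|\<^sup>B\<^sup>|)\<close> and the degree \<open>|B| |\<lambda>|\<close>. Hence the coloring zeta function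
  of the variety is the Euler product of the \<open>P(t\<^sup>|\<^sup>B\<^sup>|, T\<^sup>|\<^sup>B\<^sup>|)\<close> (\<open>coloring_zeta_euler_product\<close>). Inserting
  the product expansion of \<open>P\<close> gives the factors \<open>(1 - (t\<^sup>m T\<^sup>d)\<^sup>|\<^sup>B\<^sup>|)\<close> to the power \<open>-v d m\<close>. As the zeta
  function is the Euler product of the \<open>(1 - T\<^sup>|\<^sup>B\<^sup>|)\<^sup>-\<^sup>1\<close> (\<open>zeta_eq_euler_product\<close>), for fixed \<open>d\<close> and \<open>m\<close>
  the product over all \<open>B\<close> is \<open>Z(t\<^sup>m T\<^sup>d)\<close> to the power \<open>v d m\<close>, and interchanging the products gives the
  claim.

  Two points need care. The Frobenius map on points is given chart by chart; it is well
  defined because transition maps are defined over the base field (\<open>frob_chart\<close>), its orbits are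
  finite because the closure is algebraic over a finite field (\<open>frob_periodic\<close>), and the fixed
  points of its \<open>r\<close>-th power are the points with coordinates in the extension of degree \<open>r\<close>, of
  which there are finitely many if \<open>r > 0\<close> (\<open>rational_points_eq_fixed\<close>, \<open>finite_rational_points\<close>).
  Secondly, the products converge coefficient by coefficient, and multiplication in \<open>R[[T]]\<close> is not
  continuous for this convergence. For a given coefficient, however, all series involved have
  supports with a common lower bound, which decreases linearly with the degree in \<open>T\<close>. Under such
  a bound, agreement in a suitable finite range of coefficients is a congruence (\<open>lapprox\<close>) with
  respect to products, inverses and the substitutions \<open>t \<mapsto> t\<^sup>e, T \<mapsto> T\<^sup>e\<close>, and modulo it all products
  are finite.
\<close>

section \<open>The Frobenius map of a variety\<close>

lemma card_finite_field_gt_1: "1 < CARD('k::finite_field)"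
proof -
  have "card {0, 1 :: 'k} \<le> CARD('k)" by (rule card_mono) auto
  then show ?thesis by simp
qed

text \<open>
  The polynomial \<open>(X + 1)\<^sup>q - X\<^sup>q - 1\<close> has degree less than \<open>q\<close> and vanishes on the whole field, so its
  coefficients are zero.
\<close>
lemma of_nat_card_choose:
  assumes "0 < i" "i < CARD('k::finite_field)"
  shows "of_nat (CARD('k) choose i) = (0 :: 'k)"
proof -
  let ?q = "CARD('k)"
  define p :: "'k poly" where "p = (\<Sum>i\<in>{1..<?q}. monom (of_nat (?q choose i)) i)"
  have "poly p x = 0" for x
  proof -
    have "x + 1 = (x + 1) ^ ?q" by (simp add: finite_field_power_card_eq_same)
    also have "\<dots> = (\<Sum>i\<le>?q. of_nat (?q choose i) * x ^ i)" by (simp add: binomial_ring)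
    also have "{..?q} = insert 0 (insert ?q {1..<?q})" using card_finite_field_gt_1[where 'k='k] by auto
    also have "(\<Sum>i\<in>\<dots>. of_nat (?q choose i) * x ^ i)
                 = 1 + (x ^ ?q + (\<Sum>i\<in>{1..<?q}. of_nat (?q choose i) * x ^ i))"
      using card_finite_field_gt_1[where 'k='k] by simp
    finally show ?thesis
      by (simp add: p_def poly_sum poly_monom finite_field_power_card_eq_same)
  qed
  then have roots: "{x. poly p x = 0} = UNIV" by auto
  have "degree p \<le> ?q - 1"
    unfolding p_def by (intro degree_sum_le) (auto intro: order.trans[OF degree_monom_le])
  then have "degree p < ?q" using card_finite_field_gt_1[where 'k='k] by linarith
  then have "p = 0" using card_poly_roots_bound[of p] roots by (cases "p = 0") auto
  then have "0 = coeff p i" by simp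
  also have "\<dots> = (\<Sum>j\<in>{1..<?q}. if j = i then of_nat (?q choose j) else 0)"
    by (simp add: p_def coeff_sum)
  also have "\<dots> = of_nat (?q choose i)" using assms by (subst sum.delta) auto
  finally show ?thesis by simp
qed

lemma frobenius_add:
  fixes x y :: "'k::finite_field alg_closure"
  shows "(x + y) ^ CARD('k) = x ^ CARD('k) + y ^ CARD('k)"
proof -
  let ?q = "CARD('k)"
  have zero: "of_nat (?q choose i) = (0 :: 'k alg_closure)" if "i \<in> {1..<?q}" for i
  proof -
    have "of_nat (?q choose i) = (0::'k)" using that by (intro of_nat_card_choose) auto
    then show ?thesis by (metis to_ac_0 to_ac_of_nat)
  qed
  have "(x + y) ^ ?q = (\<Sum>i\<le>?q. of_nat (?q choose i) * x ^ i * y ^ (?q - i))"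
    by (simp add: binomial_ring)
  also have "{..?q} = insert 0 (insert ?q {1..<?q})" using card_finite_field_gt_1[where 'k='k] by auto
  also have "(\<Sum>i\<in>\<dots>. of_nat (?q choose i) * x ^ i * y ^ (?q - i)) = x ^ ?q + y ^ ?q"
    using card_finite_field_gt_1[where 'k='k] by (simp add: zero)
  finally show ?thesis .
qed

lemma frobenius_sum:
  fixes f :: "'a \<Rightarrow> 'k::finite_field alg_closure"
  shows "(\<Sum>a\<in>A. f a) ^ CARD('k) = (\<Sum>a\<in>A. f a ^ CARD('k))"
  using card_finite_field_gt_1[where 'k='k]
  by (induction A rule: infinite_finite_induct) (auto simp: frobenius_add)

lemma frobenius_inj:
  fixes x y :: "'k::finite_field alg_closure"
  assumes "x ^ CARD('k) = y ^ CARD('k)"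
  shows "x = y"
proof -
  have "x ^ CARD('k) = (x - y) ^ CARD('k) + y ^ CARD('k)"
    using frobenius_add[of "x - y" y] by simp
  then show ?thesis using assms by simp
qed

lemma frobenius_to_ac: "to_ac (a :: 'k::finite_field) ^ CARD('k) = to_ac a"
  by (metis finite_field_power_card_eq_same to_ac_power)

lemma mpeval_frobenius:
  fixes x :: "nat \<Rightarrow> 'k::finite_field alg_closure"
  shows "mpeval f (\<lambda>i. x i ^ CARD('k)) = mpeval f x ^ CARD('k)"
  unfolding mpeval_def
  by (simp add: frobenius_sum power_mult_distrib frobenius_to_ac prod_power_distrib
      mult.commute flip: power_mult)

lemma zero_locus_frobenius_iff:
  fixes x :: "nat \<Rightarrow> 'k::finite_field alg_closure"
  shows "(\<lambda>i. x i ^ CARD('k)) \<in> zero_locus S \<longleftrightarrow> x \<in> zero_locus S"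
  by (simp add: zero_locus_def mpeval_frobenius)

lemma zariski_closed_frobenius:
  fixes x :: "nat \<Rightarrow> 'k::finite_field alg_closure"
  assumes "zariski_closed_in (affine_space n) Z" "x \<in> Z"
  shows "(\<lambda>i. x i ^ CARD('k)) \<in> Z"
proof -
  obtain S where Z: "Z = affine_space n \<inter> zero_locus S"
    using assms(1) by (auto simp: zariski_closed_in_def)
  with assms(2) have x: "x \<in> affine_space n" "x \<in> zero_locus S" by auto
  have "(\<lambda>i. x i ^ CARD('k)) \<in> affine_space n"
    using x(1) by (simp add: affine_space_def)
  with x(2) show ?thesis by (simp only: Z Int_iff zero_locus_frobenius_iff)
qed

lemma zariski_open_frobenius:
  fixes x :: "nat \<Rightarrow> 'k::finite_field alg_closure"
  assumes "zariski_open_in D U" "x \<in> U" "(\<lambda>i. x i ^ CARD('k)) \<in> D"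
  shows "(\<lambda>i. x i ^ CARD('k)) \<in> U"
proof -
  obtain S where "U = D - zero_locus S"
    using assms(1) by (auto simp: zariski_open_in_def)
  with assms(2,3) show ?thesis using zero_locus_frobenius_iff[of x S] by blast
qed

lemma regular_fun_frobenius:
  fixes x :: "nat \<Rightarrow> 'k::finite_field alg_closure"
  assumes "regular_fun D f" "x \<in> D" "(\<lambda>i. x i ^ CARD('k)) \<in> D"
  shows "f (\<lambda>i. x i ^ CARD('k)) = f x ^ CARD('k)"
proof -
  obtain U a b where U: "zariski_open_in D U" "x \<in> U"
    and f: "\<forall>y\<in>U. mpeval b y \<noteq> 0 \<and> f y = mpeval a y / mpeval b y"
    using assms(1,2) unfolding regular_fun_def by metis
  have "(\<lambda>i. x i ^ CARD('k)) \<in> U" using zariski_open_frobenius[OF U assms(3)] .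
  with f U(2) show ?thesis by (simp add: mpeval_frobenius power_divide)
qed

lemma variety_coord_ge_dim:
  assumes "variety V" "i < ncharts V" "p \<in> chart_dom V i" "chart_dim V i \<le> k"
  shows "coord V i p k = 0"
proof -
  have "coord V i p \<in> affine_space (chart_dim V i)"
    using assms unfolding variety_def zariski_closed_in_def by blast
  then show ?thesis using assms(4) by (simp add: affine_space_def)
qed

lemma variety_coord_inj:
  assumes "variety V" "i < ncharts V" "p \<in> chart_dom V i" "p' \<in> chart_dom V i"
    "coord V i p = coord V i p'"
  shows "p = p'"
  using assms unfolding variety_def inj_on_def by blast

lemma variety_frobenius_point:
  fixes V :: "('k::finite_field, 'p) atlas"
  assumes V: "variety V" and i: "i < ncharts V" and p: "p \<in> chart_dom V i"
  obtains p' where "p' \<in> chart_dom V i" "coord V i p' = (\<lambda>k. coord V i p k ^ CARD('k))"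
proof -
  have "zariski_closed_in (affine_space (chart_dim V i)) (coord V i ` chart_dom V i)"
    using V i unfolding variety_def by blast
  then have "(\<lambda>k. coord V i p k ^ CARD('k)) \<in> coord V i ` chart_dom V i"
    by (rule zariski_closed_frobenius) (use p in auto)
  then show ?thesis using that by auto
qed

text \<open>
  The Frobenius image of a point does not depend on the chart: overlaps and transition maps are
  given by polynomials over the base field, which commute with raising coordinates to the
  \<open>q\<close>-th power.
\<close>
lemma variety_frobenius_change_chart:
  fixes V :: "('k::finite_field, 'p) atlas"
  assumes V: "variety V" and i: "i < ncharts V" and j: "j < ncharts V"
    and p: "p \<in> chart_dom V i" "p \<in> chart_dom V j"
    and p': "p' \<in> chart_dom V i" "coord V i p' = (\<lambda>k. coord V i p k ^ CARD('k))"
  shows "p' \<in> chart_dom V j \<and> coord V j p' = (\<lambda>k. coord V j p k ^ CARD('k))"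
proof -
  let ?D = "coord V i ` (chart_dom V i \<inter> chart_dom V j)"
  have inj: "inj_on (coord V i) (chart_dom V i)" using V i unfolding variety_def by blast
  have opn: "zariski_open_in (coord V i ` chart_dom V i) ?D"
    and reg: "\<And>k. k < chart_dim V j \<Longrightarrow> regular_fun ?D (\<lambda>x. transition V i j x k)"
    using V i j unfolding variety_def by blast+
  have xD: "coord V i p \<in> ?D" using p by blast
  have yD: "(\<lambda>k. coord V i p k ^ CARD('k)) \<in> ?D"
    by (rule zariski_open_frobenius[OF opn xD]) (use p' in \<open>metis image_eqI\<close>)
  then obtain p'' where "p'' \<in> chart_dom V i" "p'' \<in> chart_dom V j"
      "coord V i p'' = (\<lambda>k. coord V i p k ^ CARD('k))" by auto
  then have p'j: "p' \<in> chart_dom V j" using inj p' by (metis inj_onD)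
  have tr: "transition V i j (coord V i r) = coord V j r" if "r \<in> chart_dom V i" for r
    using inj that by (simp add: transition_def)
  have "coord V j p' k = coord V j p k ^ CARD('k)" for k
  proof (cases "k < chart_dim V j")
    case True
    have "transition V i j (\<lambda>k. coord V i p k ^ CARD('k)) k = transition V i j (coord V i p) k ^ CARD('k)"
      by (rule regular_fun_frobenius[OF reg[OF True] xD yD])
    then show ?thesis using tr[OF p(1)] tr[OF p'(1)] p'(2) by simp
  next
    case False
    then show ?thesis
      using variety_coord_ge_dim[OF V j p(2)] variety_coord_ge_dim[OF V j p'j] by simp
  qed
  with p'j show ?thesis by auto
qed

lemma frob_chart:
  fixes V :: "('k::finite_field, 'p) atlas"
  assumes V: "variety V" and p: "p \<in> points V"
  shows "frob V p \<in> points V"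
    and "i < ncharts V \<Longrightarrow> p \<in> chart_dom V i \<Longrightarrow>
           frob V p \<in> chart_dom V i \<and> coord V i (frob V p) = (\<lambda>k. coord V i p k ^ CARD('k))"
proof -
  let ?P = "\<lambda>p'. p' \<in> points V \<and> (\<forall>i<ncharts V. p \<in> chart_dom V i \<longrightarrow>
       p' \<in> chart_dom V i \<and> coord V i p' = (\<lambda>k. coord V i p k ^ CARD('k)))"
  have pts: "points V = (\<Union>i<ncharts V. chart_dom V i)" using V unfolding variety_def by blast
  obtain i where i: "i < ncharts V" "p \<in> chart_dom V i" using p pts by auto
  obtain p' where p': "p' \<in> chart_dom V i" "coord V i p' = (\<lambda>k. coord V i p k ^ CARD('k))"
    using variety_frobenius_point[OF V i] .
  have "?P p'"
    using variety_frobenius_change_chart[OF V i(1) _ i(2) _ p'] p'(1) i(1) pts by blast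
  moreover have "r = p'" if "?P r" for r
    using that i p' variety_coord_inj[OF V i(1)] by metis
  ultimately have "?P (frob V p)"
    unfolding frob_def by (rule theI2[where P = ?P]) auto
  then show "frob V p \<in> points V" and "i < ncharts V \<Longrightarrow> p \<in> chart_dom V i \<Longrightarrow>
           frob V p \<in> chart_dom V i \<and> coord V i (frob V p) = (\<lambda>k. coord V i p k ^ CARD('k))" for i
    by auto
qed

lemma frob_funpow_chart:
  fixes V :: "('k::finite_field, 'p) atlas"
  assumes V: "variety V" and i: "i < ncharts V" and p: "p \<in> chart_dom V i"
  shows "(frob V ^^ r) p \<in> chart_dom V i \<and>
         coord V i ((frob V ^^ r) p) = (\<lambda>k. coord V i p k ^ (CARD('k) ^ r))"
proof (induction r)
  case (Suc r)
  have "(frob V ^^ r) p \<in> points V" using Suc i V unfolding variety_def by blast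
  from frob_chart(2)[OF V this i] Suc show ?case
    by (simp add: mult.commute flip: power_mult)
qed (simp add: p)

lemma frob_funpow_eq_iff:
  fixes V :: "('k::finite_field, 'p) atlas"
  assumes V: "variety V" and i: "i < ncharts V" and p: "p \<in> chart_dom V i"
  shows "(frob V ^^ r) p = p \<longleftrightarrow> (\<forall>k. coord V i p k \<in> subfield_pow r)"
proof -
  have "(frob V ^^ r) p = p \<longleftrightarrow> coord V i ((frob V ^^ r) p) = coord V i p"
    using variety_coord_inj[OF V i _ p] frob_funpow_chart[OF V i p] by metis
  also have "\<dots> \<longleftrightarrow> (\<forall>k. coord V i p k \<in> subfield_pow r)"
    using frob_funpow_chart[OF V i p] by (simp add: fun_eq_iff subfield_pow_def)
  finally show ?thesis .
qed

lemma rational_points_eq_fixed: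
  assumes V: "variety V"
  shows "rational_points V r = {p \<in> points V. (frob V ^^ r) p = p}"
proof -
  have "points V = (\<Union>i<ncharts V. chart_dom V i)" using V unfolding variety_def by blast
  then show ?thesis
    unfolding rational_points_def using frob_funpow_eq_iff[OF V] by auto
qed

lemma finite_subfield_pow:
  assumes "0 < r"
  shows "finite (subfield_pow r :: 'k::finite_field alg_closure set)"
proof -
  let ?N = "CARD('k) ^ r"
  define p :: "'k alg_closure poly" where "p = monom 1 ?N - monom 1 1"
  have "1 < ?N" using card_finite_field_gt_1[where 'k='k] assms by (rule one_less_power)
  then have "coeff p ?N = 1" by (simp add: p_def)
  then have "p \<noteq> 0" by auto
  moreover have "subfield_pow r = {x. poly p x = 0}"
    by (simp add: subfield_pow_def p_def poly_monom)
  ultimately show ?thesis using poly_roots_finite by metis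
qed

lemma finite_rational_points:
  fixes V :: "('k::finite_field, 'p) atlas"
  assumes V: "variety V" and r: "0 < r"
  shows "finite (rational_points V r)"
proof -
  define F where "F = (\<lambda>i. {x :: nat \<Rightarrow> 'k alg_closure. \<forall>k.
      (k \<in> {..<chart_dim V i} \<longrightarrow> x k \<in> subfield_pow r) \<and> (k \<notin> {..<chart_dim V i} \<longrightarrow> x k = 0)})"
  have F: "finite (F i)" for i
    unfolding F_def by (rule finite_set_of_finite_funs) (use finite_subfield_pow[OF r] in auto)
  have "rational_points V r \<subseteq> (\<Union>i<ncharts V. coord V i -` F i \<inter> chart_dom V i)"
    using variety_coord_ge_dim[OF V] by (auto simp: rational_points_def F_def not_less)
  moreover have "finite (coord V i -` F i \<inter> chart_dom V i)" if "i < ncharts V" for i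
    using that V F unfolding variety_def by (intro finite_vimage_IntI) auto
  ultimately show ?thesis by (auto elim: finite_subset)
qed

lemma subfield_pow_dvd:
  fixes x :: "'k::finite_field alg_closure"
  assumes x: "x \<in> subfield_pow r" and "r dvd s"
  shows "x \<in> subfield_pow s"
proof -
  obtain j where s: "s = r * j" using assms(2) by auto
  have "x ^ (CARD('k) ^ (r * j)) = x"
  proof (induction j)
    case (Suc j)
    have "x ^ (CARD('k) ^ (r * Suc j)) = (x ^ (CARD('k) ^ r)) ^ (CARD('k) ^ (r * j))"
      by (simp add: power_add flip: power_mult)
    then show ?case using x Suc by (simp add: subfield_pow_def)
  qed simp
  then show ?thesis by (simp add: subfield_pow_def s)
qed

text \<open>
  The Frobenius map permutes the finitely many roots of a polynomial over the base field, so
  some power of it fixes any given element.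
\<close>
lemma in_subfield_pow:
  fixes x :: "'k::finite_field alg_closure"
  obtains r where "0 < r" "x \<in> subfield_pow r"
proof -
  let ?q = "CARD('k)"
  obtain f :: "'k poly" where f: "f \<noteq> 0" "poly (map_poly to_ac f) x = 0"
    using alg_closure_algebraic[of x] .
  let ?f = "map_poly to_ac f"
  have frob: "poly ?f (y ^ ?q) = poly ?f y ^ ?q" for y
    by (simp add: poly_altdef frobenius_sum power_mult_distrib frobenius_to_ac coeff_map_poly
        mult.commute flip: power_mult)
  have root: "poly ?f (x ^ (?q ^ i)) = 0" for i
  proof (induction i)
    case (Suc i)
    have "x ^ (?q ^ Suc i) = (x ^ (?q ^ i)) ^ ?q" by (simp only: power_Suc2 power_mult)
    then show ?case using Suc frob[of "x ^ (?q ^ i)"] by (simp only: power_0_left) simp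
  qed (simp add: f(2))
  have "coeff ?f (degree f) = to_ac (lead_coeff f)" by (simp add: coeff_map_poly)
  with f(1) have "?f \<noteq> 0" by (auto simp: to_ac_eq_0_iff)
  then have "finite {y. poly ?f y = 0}" by (rule poly_roots_finite)
  then have "finite (range (\<lambda>i. x ^ (?q ^ i)))" by (rule finite_subset[rotated]) (use root in auto)
  then have "\<not> inj (\<lambda>i. x ^ (?q ^ i))" using finite_imageD infinite_UNIV_nat by blast
  then obtain i j where "i < j" and eq: "x ^ (?q ^ i) = x ^ (?q ^ j)"
    unfolding inj_def by (metis linorder_neqE_nat)
  then obtain r where r: "j = i + r" "0 < r" using less_imp_add_positive by blast
  have "x = x ^ (?q ^ r)" using eq unfolding r(1)
  proof (induction i)
    case (Suc i)
    then have "(x ^ (?q ^ i)) ^ ?q = (x ^ (?q ^ (i + r))) ^ ?q"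
      by (simp add: mult.commute flip: power_mult)
    from frobenius_inj[OF this] show ?case by (rule Suc.IH)
  qed simp
  with r(2) that show ?thesis by (simp add: subfield_pow_def)
qed

lemma frob_periodic:
  fixes V :: "('k::finite_field, 'p) atlas"
  assumes V: "variety V" and p: "p \<in> points V"
  shows "\<exists>r>0. (frob V ^^ r) p = p"
proof -
  have "points V = (\<Union>i<ncharts V. chart_dom V i)" using V unfolding variety_def by blast
  then obtain i where i: "i < ncharts V" "p \<in> chart_dom V i" using p by auto
  have "\<forall>k. \<exists>r>0. coord V i p k \<in> subfield_pow r" using in_subfield_pow by metis
  then obtain r where r: "\<And>k. 0 < r k" "\<And>k. coord V i p k \<in> subfield_pow (r k)" by metis
  define s where "s = (\<Prod>k<chart_dim V i. r k)"
  have "coord V i p k \<in> subfield_pow s" for k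
  proof (cases "k < chart_dim V i")
    case True
    then have "r k dvd s" unfolding s_def by (intro dvd_prodI) auto
    then show ?thesis using subfield_pow_dvd[OF r(2)] by blast
  next
    case False
    then show ?thesis using variety_coord_ge_dim[OF V i] by (simp add: subfield_pow_def)
  qed
  moreover have "0 < s" using r(1) by (simp add: s_def prod_pos)
  ultimately show ?thesis using frob_funpow_eq_iff[OF V i] by blast
qed

section \<open>Integer powers of power series\<close>

text \<open>
  The coefficient ring need not be a field, so inverses are those of the series with constant
  term \<open>1\<close>, written with \<open>fps_right_inverse\<close>.
\<close>
lemma fps_mult_right_inverse_1:
  fixes f :: "'a::comm_ring_1 fps"
  assumes "fps_nth f 0 = 1"
  shows "f * fps_right_inverse f 1 = 1"
  using assms by (intro fps_right_inverse) simp

lemma fps_right_inverse_unique: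
  fixes f :: "'a::comm_ring_1 fps"
  assumes "fps_nth f 0 = 1" "f * g = 1"
  shows "g = fps_right_inverse f 1"
proof -
  have "g = g * (f * fps_right_inverse f 1)" using fps_mult_right_inverse_1[OF assms(1)] by simp
  also have "\<dots> = (f * g) * fps_right_inverse f 1" by (simp add: mult_ac)
  finally show ?thesis using assms(2) by simp
qed

lemma fps_nth_0_right_inverse: "fps_nth (fps_right_inverse f 1) 0 = 1"
  by simp

lemma fps_right_inverse_idem:
  fixes f :: "'a::comm_ring_1 fps"
  assumes "fps_nth f 0 = 1"
  shows "fps_right_inverse (fps_right_inverse f 1) 1 = f"
  using fps_right_inverse_unique[OF fps_nth_0_right_inverse, of f f]
    fps_mult_right_inverse_1[OF assms] by (simp add: mult.commute)

lemma fps_right_inverse_mult_1: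
  fixes f g :: "'a::comm_ring_1 fps"
  assumes "fps_nth f 0 = 1" "fps_nth g 0 = 1"
  shows "fps_right_inverse (f * g) 1 = fps_right_inverse f 1 * fps_right_inverse g 1"
proof (rule fps_right_inverse_unique[symmetric])
  have "(f * g) * (fps_right_inverse f 1 * fps_right_inverse g 1)
          = (f * fps_right_inverse f 1) * (g * fps_right_inverse g 1)" by (simp only: mult_ac)
  then show "(f * g) * (fps_right_inverse f 1 * fps_right_inverse g 1) = 1"
    using assms by (simp add: fps_mult_right_inverse_1)
qed (use assms in simp)

lemma fps_nth_0_prod_1:
  "(\<And>i. i \<in> S \<Longrightarrow> fps_nth (f i) 0 = 1) \<Longrightarrow> fps_nth (\<Prod>i\<in>S. f i) 0 = (1 :: 'a::comm_ring_1)"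
  by (induction S rule: infinite_finite_induct) auto

lemma fps_zpow_0 [simp]: "fps_zpow f 0 = 1"
  by (simp add: fps_zpow_def)

lemma fps_zpow_mult:
  fixes f g :: "'a::comm_ring_1 fps"
  assumes "fps_nth f 0 = 1" "fps_nth g 0 = 1"
  shows "fps_zpow (f * g) k = fps_zpow f k * fps_zpow g k"
  using assms by (simp add: fps_zpow_def fps_right_inverse_mult_1 power_mult_distrib)

lemma fps_zpow_one: "fps_zpow (1 :: 'a::comm_ring_1 fps) k = 1"
  proof -
  have "fps_right_inverse 1 1 = (1 :: 'a fps)" using fps_right_inverse_unique[of 1 1] by simp
  then show ?thesis by (simp only: fps_zpow_def power_one if_cancel)
qed

lemma fps_zpow_prod:
  fixes f :: "'i \<Rightarrow> 'a::comm_ring_1 fps"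
  assumes "\<And>i. i \<in> S \<Longrightarrow> fps_nth (f i) 0 = 1"
  shows "fps_zpow (\<Prod>i\<in>S. f i) k = (\<Prod>i\<in>S. fps_zpow (f i) k)"
  using assms
  by (induction S rule: infinite_finite_induct) (auto simp: fps_zpow_one fps_zpow_mult fps_nth_0_prod_1)

lemma fps_zpow_right_inverse:
  fixes f :: "'a::comm_ring_1 fps"
  assumes "fps_nth f 0 = 1"
  shows "fps_zpow (fps_right_inverse f 1) k = fps_zpow f (- k)"
  using assms by (cases "k = 0") (auto simp: fps_zpow_def fps_right_inverse_idem)

section \<open>Substitution homomorphisms\<close>

text \<open>
  The map \<open>\<Sum>\<^sub>k a\<^sub>k T\<^sup>k \<mapsto> \<Sum>\<^sub>k h\<^sub>k(a\<^sub>k) T\<^sup>k\<^sup>e\<close>. For suitable \<open>h\<close> it is the change of coefficients, the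
  substitution of \<open>t\<^sup>m T\<^sup>e\<close> for \<open>T\<close>, or the substitution of \<open>t\<^sup>e\<close> and \<open>T\<^sup>e\<close> for \<open>t\<close> and \<open>T\<close>.
\<close>
definition fps_dilate :: "nat \<Rightarrow> (nat \<Rightarrow> 'a::comm_ring_1 \<Rightarrow> 'b::comm_ring_1) \<Rightarrow> 'a fps \<Rightarrow> 'b fps"
  where "fps_dilate e h F = Abs_fps (\<lambda>k. if e dvd k then h (k div e) (fps_nth F (k div e)) else 0)"

lemma fps_nth_dilate:
  "fps_nth (fps_dilate e h F) k = (if e dvd k then h (k div e) (fps_nth F (k div e)) else 0)"
  by (simp add: fps_dilate_def)

text \<open>The conditions on \<open>h\<close> under which \<^const>\<open>fps_dilate\<close> is a ring homomorphism.\<close>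
locale graded_hom =
  fixes h :: "nat \<Rightarrow> 'a::comm_ring_1 \<Rightarrow> 'b::comm_ring_1"
  assumes hom_add: "h k (x + y) = h k x + h k y"
    and hom_mult: "h (j + k) (x * y) = h j x * h k y"
    and hom_one: "h 0 1 = 1"
begin

lemma hom_zero: "h k 0 = 0"
  using hom_add[of k 0 0] by simp

lemma hom_uminus: "h k (- x) = - h k x"
  using hom_add[of k x "- x"] hom_zero by (simp add: eq_neg_iff_add_eq_0 add.commute)

lemma hom_sum: "h k (\<Sum>i\<in>S. f i) = (\<Sum>i\<in>S. h k (f i))"
  by (induction S rule: infinite_finite_induct) (auto simp: hom_zero hom_add)

lemma dilate_one:
  assumes "0 < e"
  shows "fps_dilate e h 1 = 1"
  using assms by (auto simp: fps_eq_iff fps_nth_dilate hom_one hom_zero elim!: dvdE)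

lemma dilate_diff: "fps_dilate e h (F - G) = fps_dilate e h F - fps_dilate e h G"
  using hom_add[of _ _ "- _"] hom_uminus
  by (simp add: fps_eq_iff fps_nth_dilate flip: add_uminus_conv_diff)

lemma dilate_mult:
  assumes e: "0 < e"
  shows "fps_dilate e h (F * G) = fps_dilate e h F * fps_dilate e h G"
proof (rule fps_ext)
  fix k
  let ?f = "\<lambda>i. fps_nth (fps_dilate e h F) i * fps_nth (fps_dilate e h G) (k - i)"
  show "fps_nth (fps_dilate e h (F * G)) k = fps_nth (fps_dilate e h F * fps_dilate e h G) k"
  proof (cases "e dvd k")
    case True
    then obtain l where k: "k = e * l" by blast
    have "(\<Sum>i=0..k. ?f i) = (\<Sum>i\<in>(*) e ` {0..l}. ?f i)"
    proof (rule sum.mono_neutral_right)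
      show "\<forall>i\<in>{0..k} - (*) e ` {0..l}. ?f i = 0"
        using e by (auto simp: k fps_nth_dilate elim!: dvdE)
    qed (use e in \<open>auto simp: k\<close>)
    also have "\<dots> = (\<Sum>i=0..l. ?f (e * i))"
      using e by (subst sum.reindex) (auto simp: inj_on_def)
    also have "\<dots> = (\<Sum>i=0..l. h l (fps_nth F i * fps_nth G (l - i)))"
    proof (rule sum.cong)
      fix i assume i: "i \<in> {0..l}"
      have "h (i + (l - i)) (fps_nth F i * fps_nth G (l - i)) = h i (fps_nth F i) * h (l - i) (fps_nth G (l - i))"
        by (rule hom_mult)
      moreover have "e * l - e * i = e * (l - i)" by (simp add: diff_mult_distrib2)
      ultimately show "?f (e * i) = h l (fps_nth F i * fps_nth G (l - i))"
        using e i by (simp add: fps_nth_dilate k)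
    qed simp
    also have "\<dots> = fps_nth (fps_dilate e h (F * G)) k"
      using e by (simp add: fps_nth_dilate k fps_mult_nth hom_sum)
    finally show ?thesis by (simp add: fps_mult_nth)
  next
    case False
    have "?f i = 0" if "i \<in> {0..k}" for i
    proof (rule ccontr)
      assume "?f i \<noteq> 0"
      then have "e dvd i" "e dvd k - i" by (auto simp: fps_nth_dilate split: if_splits)
      then have "e dvd i + (k - i)" by (rule dvd_add)
      with that False show False by simp
    qed
    then have "(\<Sum>i=0..k. ?f i) = 0" by (intro sum.neutral) auto
    with False show ?thesis by (simp add: fps_mult_nth fps_nth_dilate)
  qed
qed

lemma fps_nth_0_dilate: "fps_nth F 0 = 1 \<Longrightarrow> fps_nth (fps_dilate e h F) 0 = 1"
  by (simp add: fps_nth_dilate hom_one)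

lemma dilate_prod:
  assumes "0 < e"
  shows "fps_dilate e h (\<Prod>i\<in>S. F i) = (\<Prod>i\<in>S. fps_dilate e h (F i))"
  by (induction S rule: infinite_finite_induct) (simp_all add: dilate_one dilate_mult assms)

lemma dilate_power:
  assumes "0 < e"
  shows "fps_dilate e h (F ^ n) = fps_dilate e h F ^ n"
  by (induction n) (simp_all add: dilate_one dilate_mult assms)

lemma dilate_right_inverse:
  assumes "0 < e" "fps_nth F 0 = 1"
  shows "fps_dilate e h (fps_right_inverse F 1) = fps_right_inverse (fps_dilate e h F) 1"
proof (rule fps_right_inverse_unique)
  show "fps_dilate e h F * fps_dilate e h (fps_right_inverse F 1) = 1"
    using assms by (simp add: dilate_one fps_mult_right_inverse_1 flip: dilate_mult)
qed (use assms in \<open>simp add: fps_nth_0_dilate\<close>)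

lemma dilate_zpow:
  assumes "0 < e" "fps_nth F 0 = 1"
  shows "fps_dilate e h (fps_zpow F k) = fps_zpow (fps_dilate e h F) k"
  using assms by (simp add: fps_zpow_def dilate_power dilate_right_inverse)

end

lemma lcoeff_sum: "lcoeff (\<Sum>i\<in>S. f i) m = (\<Sum>i\<in>S. lcoeff (f i) m)"
  by (induction S rule: infinite_finite_induct) (auto simp: zero_laurent.rep_eq plus_laurent.rep_eq)

lemma lcoeff_lmonom_mult: "lcoeff (lmonom a * f) m = lcoeff f (m - a)"
proof -
  have "lcoeff (lmonom a * f) m = (\<Sum>k\<in>{a}. lcoeff (lmonom a) k * lcoeff f (m - k))"
    by (rule lcoeff_times_superset) (auto simp: lmonom.rep_eq split: if_splits)
  then show ?thesis by (simp add: lmonom.rep_eq)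
qed

lemma lmonom_mult: "lmonom a * lmonom b = lmonom (a + b)"
  by (rule laurent_eqI) (auto simp: lcoeff_lmonom_mult lmonom.rep_eq)

lemma lmonom_0: "lmonom 0 = 1"
  by (rule laurent_eqI) (simp add: lmonom.rep_eq one_laurent.rep_eq)

lemma lmonom_power: "lmonom a ^ n = lmonom (\<chi> i. int n * a $ i)"
proof (induction n)
  case 0
  have "(\<chi> i. int 0 * a $ i) = 0" by (simp add: vec_eq_iff)
  then show ?case by (simp add: lmonom_0)
next
  case (Suc n)
  have "a + (\<chi> i. int n * a $ i) = (\<chi> i. int (Suc n) * a $ i)"
    by (simp add: vec_eq_iff algebra_simps)
  with Suc show ?case by (simp add: lmonom_mult)
qed

lemma lsubst_pow_add: "lsubst_pow d (f + g) = lsubst_pow d f + lsubst_pow d g"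
  by (rule laurent_eqI) (simp add: lsubst_pow.rep_eq plus_laurent.rep_eq)

lemma lsubst_pow_lmonom:
  assumes d: "0 < d"
  shows "lsubst_pow d (lmonom a) = lmonom a ^ d"
proof (rule laurent_eqI)
  fix m
  have "(\<forall>i. int d dvd m $ i) \<and> (\<chi> i. m $ i div int d) = a \<longleftrightarrow> m = (\<chi> i. int d * a $ i)"
    using d by (auto simp: vec_eq_iff) (metis dvd_mult_div_cancel)
  then show "lcoeff (lsubst_pow d (lmonom a)) m = lcoeff (lmonom a ^ d) m"
    by (auto simp: lsubst_pow.rep_eq lmonom_power lmonom.rep_eq)
qed

lemma lsubst_pow_one: "0 < d \<Longrightarrow> lsubst_pow d 1 = 1"
  using lsubst_pow_lmonom[of d 0] by (simp add: lmonom_0)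

lemma lsubst_pow_mult:
  assumes d: "0 < d"
  shows "lsubst_pow d (f * g) = lsubst_pow d f * lsubst_pow d g"
proof (rule laurent_eqI)
  fix m
  define s where "s a = (\<chi> i. int d * a $ i)" for a :: "int ^ 'a"
  have inj: "inj s" using d by (auto simp: inj_def vec_eq_iff s_def)
  have Ds: "(\<chi> i. s a $ i div int d) = a" for a using d by (simp add: vec_eq_iff s_def)
  have dvd: "int d dvd s a $ i" for a i by (simp add: s_def)
  have co: "lcoeff (lsubst_pow d f) (s a) = lcoeff f a" for f a
    by (simp add: lsubst_pow.rep_eq Ds dvd)
  have nz: "\<exists>a. m = s a" if "lcoeff (lsubst_pow d f) m \<noteq> 0" for f m
  proof -
    have "\<forall>i. int d dvd m $ i" using that by (auto simp: lsubst_pow.rep_eq split: if_splits)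
    then have "m = s (\<chi> i. m $ i div int d)" by (simp add: vec_eq_iff s_def)
    then show ?thesis by blast
  qed
  have s_diff: "s a - s b = s (a - b)" for a b
    by (simp add: s_def vec_eq_iff algebra_simps)
  have s_add: "s a + s b = s (a + b)" for a b
    by (simp add: s_def vec_eq_iff algebra_simps)
  show "lcoeff (lsubst_pow d (f * g)) m = lcoeff (lsubst_pow d f * lsubst_pow d g) m"
  proof (cases "\<exists>n. m = s n")
    case True
    then obtain n where m: "m = s n" by blast
    let ?S = "{a. lcoeff f a \<noteq> 0 \<and> lcoeff g (n - a) \<noteq> 0}"
    have fin: "finite ?S" by (intro finite_laurent_conv laurent_supp_lcoeff)
    have "lcoeff (lsubst_pow d f * lsubst_pow d g) m
        = (\<Sum>a\<in>s ` ?S. lcoeff (lsubst_pow d f) a * lcoeff (lsubst_pow d g) (m - a))"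
    proof (rule lcoeff_times_superset)
      show "{a. lcoeff (lsubst_pow d f) a \<noteq> 0 \<and> lcoeff (lsubst_pow d g) (m - a) \<noteq> 0} \<subseteq> s ` ?S"
      proof safe
        fix a assume *: "lcoeff (lsubst_pow d f) a \<noteq> 0" "lcoeff (lsubst_pow d g) (m - a) \<noteq> 0"
        obtain b where "a = s b" using nz[OF *(1)] by blast
        with * show "a \<in> s ` ?S" by (auto simp: m s_diff co)
      qed
    qed (use fin in auto)
    also have "\<dots> = (\<Sum>a\<in>?S. lcoeff f a * lcoeff g (n - a))"
      using inj by (subst sum.reindex) (auto simp: m s_diff co intro: inj_on_subset)
    also have "\<dots> = lcoeff (f * g) n" by (simp add: times_laurent.rep_eq)
    finally show ?thesis by (simp add: m co)
  next
    case False
    have "{a. lcoeff (lsubst_pow d f) a \<noteq> 0 \<and> lcoeff (lsubst_pow d g) (m - a) \<noteq> 0} = {}"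
    proof safe
      fix a assume *: "lcoeff (lsubst_pow d f) a \<noteq> 0" "lcoeff (lsubst_pow d g) (m - a) \<noteq> 0"
      obtain b c where "a = s b" "m - a = s c" using nz[OF *(1)] nz[OF *(2)] by blast
      then have "m = s (b + c)" by (metis s_add add_diff_cancel_left' diff_add_cancel add.commute)
      with False show "a \<in> {}" by blast
    qed
    then have "lcoeff (lsubst_pow d f * lsubst_pow d g) m = 0"
      unfolding times_laurent.rep_eq by (metis sum.empty)
    moreover have "lcoeff (lsubst_pow d (f * g)) m = 0" using nz False by blast
    ultimately show ?thesis by simp
  qed
qed

lemma graded_hom_lsubst_pow: "0 < d \<Longrightarrow> graded_hom (\<lambda>_. lsubst_pow d)"
  by unfold_locales (simp_all add: lsubst_pow_add lsubst_pow_mult lsubst_pow_one)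

lemma graded_hom_of_int: "graded_hom (\<lambda>_. of_int)"
  by unfold_locales simp_all

lemma graded_hom_of_int_lmonom: "graded_hom (\<lambda>k a. of_int a * lmonom m ^ k)"
  by unfold_locales (simp_all add: algebra_simps power_add)

lemma of_int_fps_conv_dilate: "of_int_fps F = fps_dilate 1 (\<lambda>_. of_int) F"
  by (simp add: fps_eq_iff of_int_fps_def fps_nth_dilate)

lemma tT_power: "tT d m ^ j = fps_const (lmonom m ^ j) * fps_X ^ (d * j)"
  by (simp add: tT_def power_mult_distrib power_mult flip: fps_const_power)

lemma fps_nth_tT_power: "fps_nth (tT d m ^ j) k = (if k = d * j then lmonom m ^ j else 0)"
  by (simp add: tT_power)

lemma fps_nth_tT: "fps_nth (tT d m) k = (if k = d then lmonom m else 0)"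
  using fps_nth_tT_power[of d m 1] by simp

lemma of_int_fps_compose_tT:
  assumes d: "0 < d"
  shows "of_int_fps F oo tT d m = fps_dilate d (\<lambda>k a. of_int a * lmonom m ^ k) F"
proof (rule fps_ext)
  fix k
  have "fps_nth (of_int_fps F oo tT d m) k
      = (\<Sum>i=0..k. if i = k div d \<and> d dvd k then of_int (fps_nth F i) * lmonom m ^ i else 0)"
    unfolding fps_compose_nth of_int_fps_def fps_nth_tT_power
    using d by (intro sum.cong) auto
  also have "\<dots> = fps_nth (fps_dilate d (\<lambda>k a. of_int a * lmonom m ^ k) F) k"
    by (cases "d dvd k") (auto simp: fps_nth_dilate)
  finally show "fps_nth (of_int_fps F oo tT d m) k
      = fps_nth (fps_dilate d (\<lambda>k a. of_int a * lmonom m ^ k) F) k" .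
qed

lemma fps_nth_0_one_minus_tT: "0 < d \<Longrightarrow> fps_nth (1 - tT d m ^ j) 0 = 1" if "0 < j"
  using that by (simp add: fps_nth_tT_power)

lemma dilate_X_power:
  assumes d: "0 < d"
  shows "fps_dilate d (\<lambda>k a. of_int a * lmonom m ^ k) (fps_X ^ j) = tT d m ^ j"
  using d by (auto simp: fps_eq_iff fps_nth_dilate fps_nth_tT_power elim!: dvdE)

lemma dilate_lsubst_tT:
  assumes e: "0 < e"
  shows "fps_dilate e (\<lambda>_. lsubst_pow e) (tT d m) = tT d m ^ e"
proof -
  interpret graded_hom "\<lambda>_. lsubst_pow e" using graded_hom_lsubst_pow[OF e] .
  show ?thesis
    using e by (auto simp: fps_eq_iff fps_nth_dilate fps_nth_tT fps_nth_tT_power hom_zero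
        lsubst_pow_lmonom mult.commute elim!: dvdE)
qed

section \<open>Approximation of power series with Laurent coefficients\<close>

text \<open>
  For all \<open>k \<le> n\<close>, the exponents of the coefficient of \<open>T\<^sup>k\<close> are at least \<open>-c k\<close>. Equivalently, modulo
  \<open>T\<^sup>n\<^sup>+\<^sup>1\<close>, substituting \<open>(t\<^sub>1\<cdots>t\<^sub>N)\<^sup>c T\<close> for \<open>T\<close> gives a series without negative exponents.
\<close>
definition lbounded :: "nat \<Rightarrow> nat \<Rightarrow> 'n::finite laurent fps \<Rightarrow> bool"
  where "lbounded c n F \<longleftrightarrow>
    (\<forall>k\<le>n. \<forall>m. lcoeff (fps_nth F k) m \<noteq> 0 \<longrightarrow> (\<forall>i. - int (c * k) \<le> m $ i))"

text \<open>
  Two such series are identified when, after that substitution, the coefficients of all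
  \<open>t\<^sup>m T\<^sup>k\<close> with \<open>k \<le> n\<close> and all \<open>m\<^sub>i \<le> L\<close> agree. Since no negative exponents are left, the series
  without monomials in this finite range form an ideal. Agreement in finitely many coefficients is not
  preserved by products in \<open>R[[T]]\<close> without the bound on the supports.
\<close>
definition lapprox :: "nat \<Rightarrow> nat \<Rightarrow> nat \<Rightarrow> 'n::finite laurent fps \<Rightarrow> 'n laurent fps \<Rightarrow> bool"
  where "lapprox c n L F G \<longleftrightarrow> lbounded c n F \<and> lbounded c n G \<and>
    (\<forall>k\<le>n. \<forall>m. (\<forall>i. m $ i + int (c * k) \<le> int L) \<longrightarrow>
       lcoeff (fps_nth F k) m = lcoeff (fps_nth G k) m)"

lemma lboundedD:
  "lbounded c n F \<Longrightarrow> k \<le> n \<Longrightarrow> lcoeff (fps_nth F k) m \<noteq> 0 \<Longrightarrow> - int (c * k) \<le> m $ i"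
  by (simp add: lbounded_def)

lemma lapprox_refl: "lapprox c n L F F \<longleftrightarrow> lbounded c n F"
  by (auto simp: lapprox_def)

lemma lapprox_sym: "lapprox c n L F G \<Longrightarrow> lapprox c n L G F"
  by (auto simp: lapprox_def)

lemma lapprox_trans [trans]: "lapprox c n L F G \<Longrightarrow> lapprox c n L G H \<Longrightarrow> lapprox c n L F H"
  by (simp add: lapprox_def)

lemma lbounded_one: "lbounded c n 1"
  by (auto simp: lbounded_def one_laurent.rep_eq zero_laurent.rep_eq split: if_splits)

lemma lbounded_diff: "lbounded c n F \<Longrightarrow> lbounded c n G \<Longrightarrow> lbounded c n (F - G)"
  unfolding lbounded_def fps_sub_nth minus_laurent.rep_eq by (metis diff_self)

lemma lbounded_tT:
  assumes "d \<le> n \<Longrightarrow> (\<forall>i. - int c \<le> m $ i)" "0 < d"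
  shows "lbounded c n (tT d m)"
  unfolding lbounded_def
proof (intro allI impI)
  fix k m' i assume k: "k \<le> n" and nz: "lcoeff (fps_nth (tT d m) k) m' \<noteq> 0"
  then have "k = d" "m' = m"
    by (auto simp: fps_nth_tT lmonom.rep_eq zero_laurent.rep_eq split: if_splits)
  moreover have "int c \<le> int (c * d)" using assms(2) by (cases d) auto
  moreover have "- int c \<le> m $ i" using assms(1) k \<open>k = d\<close> by simp
  ultimately show "- int (c * k) \<le> m' $ i" by (metis neg_le_iff_le order_trans)
qed

lemma lcoeff_fps_mult_neq_0:
  assumes "lcoeff (fps_nth (F * G) k) m \<noteq> 0"
  obtains j a where "j \<le> k" "lcoeff (fps_nth F j) a \<noteq> 0" "lcoeff (fps_nth G (k - j)) (m - a) \<noteq> 0"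
proof -
  have "(\<Sum>j=0..k. lcoeff (fps_nth F j * fps_nth G (k - j)) m) \<noteq> 0"
    using assms by (simp add: fps_mult_nth lcoeff_sum)
  then obtain j where j: "j \<le> k" "lcoeff (fps_nth F j * fps_nth G (k - j)) m \<noteq> 0"
    by (metis (no_types, lifting) atLeastAtMost_iff sum.neutral)
  have "{a. lcoeff (fps_nth F j) a \<noteq> 0 \<and> lcoeff (fps_nth G (k - j)) (m - a) \<noteq> 0} \<noteq> {}"
    using j(2) unfolding times_laurent.rep_eq by (metis sum.empty)
  with j(1) that show ?thesis by blast
qed

lemma lbounded_mult:
  assumes "lbounded c n F" "lbounded c n G"
  shows "lbounded c n (F * G)"
  unfolding lbounded_def
proof (intro allI impI)
  fix k m i assume k: "k \<le> n" and nz: "lcoeff (fps_nth (F * G) k) m \<noteq> 0"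
  obtain j a where j: "j \<le> k" "lcoeff (fps_nth F j) a \<noteq> 0"
    "lcoeff (fps_nth G (k - j)) (m - a) \<noteq> 0" using lcoeff_fps_mult_neq_0[OF nz] .
  have "- int (c * j) \<le> a $ i" "- int (c * (k - j)) \<le> (m - a) $ i"
    using lboundedD[OF assms(1) _ j(2)] lboundedD[OF assms(2) _ j(3)] j(1) k by auto
  moreover have "int (c * k) = int (c * j) + int (c * (k - j))"
    using j(1) by (metis distrib_left le_add_diff_inverse of_nat_add)
  ultimately show "- int (c * k) \<le> m $ i" by simp
qed

text \<open>
  If a monomial \<open>t\<^sup>m T\<^sup>k\<close> in the range to be compared is a product of \<open>t\<^sup>a T\<^sup>j\<close> and \<open>t\<^sup>m\<^sup>-\<^sup>a T\<^sup>k\<^sup>-\<^sup>j\<close>, of which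
  one is out of this range, then the other is below the lower bound on the supports.
\<close>
lemma lapprox_mult:
  assumes FG: "lapprox c n L F F'" "lapprox c n L G G'"
  shows "lapprox c n L (F * G) (F' * G')"
proof -
  have bnd: "lbounded c n F" "lbounded c n F'" "lbounded c n G" "lbounded c n G'"
    using FG by (auto simp: lapprox_def)
  have "lcoeff (fps_nth (F * G) k) m = lcoeff (fps_nth (F' * G') k) m"
    if k: "k \<le> n" and m: "\<forall>i. m $ i + int (c * k) \<le> int L" for k m
  proof -
    have "lcoeff (fps_nth F j * fps_nth G (k - j)) m = lcoeff (fps_nth F' j * fps_nth G' (k - j)) m"
      if j: "j \<le> k" for j
    proof -
      let ?S = "\<lambda>F G. {a. lcoeff (fps_nth F j) a \<noteq> 0 \<and> lcoeff (fps_nth G (k - j)) (m - a) \<noteq> 0}"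
      have fin: "finite (?S F G \<union> ?S F' G')"
        by (intro finite_UnI finite_laurent_conv laurent_supp_lcoeff)
      have jk: "int (c * k) = int (c * j) + int (c * (k - j))"
        using j by (metis distrib_left le_add_diff_inverse of_nat_add)
      have "lcoeff (fps_nth F j) a * lcoeff (fps_nth G (k - j)) (m - a)
          = lcoeff (fps_nth F' j) a * lcoeff (fps_nth G' (k - j)) (m - a)" for a
      proof -
        consider (1) "\<forall>i. a $ i + int (c * j) \<le> int L" "\<forall>i. (m - a) $ i + int (c * (k - j)) \<le> int L"
          | (2) i where "int L < a $ i + int (c * j)"
          | (3) i where "int L < (m - a) $ i + int (c * (k - j))"
          by (meson not_le)
        then show ?thesis
        proof cases
          case 1
          with FG j k show ?thesis by (simp add: lapprox_def)
        next
          case 2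
          have "\<not> - int (c * (k - j)) \<le> (m - a) $ i" using 2 m[rule_format, of i] jk by simp
          then have "lcoeff (fps_nth G (k - j)) (m - a) = 0" "lcoeff (fps_nth G' (k - j)) (m - a) = 0"
            using lboundedD[OF bnd(3)] lboundedD[OF bnd(4)] j k by (meson diff_le_self le_trans)+
          then show ?thesis by simp
        next
          case 3
          have "\<not> - int (c * j) \<le> a $ i" using 3 m[rule_format, of i] jk by simp
          then have "lcoeff (fps_nth F j) a = 0" "lcoeff (fps_nth F' j) a = 0"
            using lboundedD[OF bnd(1)] lboundedD[OF bnd(2)] j k by (meson le_trans)+
          then show ?thesis by simp
        qed
      qed
      then show ?thesis
        using lcoeff_times_superset[OF fin, of "fps_nth F j" "fps_nth G (k - j)" m]
          lcoeff_times_superset[OF fin, of "fps_nth F' j" "fps_nth G' (k - j)" m] by auto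
    qed
    then show ?thesis by (simp add: fps_mult_nth lcoeff_sum)
  qed
  with bnd show ?thesis by (simp add: lapprox_def lbounded_mult)
qed

lemma lbounded_right_inverse:
  assumes F: "lbounded c n F" "fps_nth F 0 = 1"
  shows "lbounded c n (fps_right_inverse F 1)"
proof -
  let ?I = "fps_right_inverse F 1"
  have "\<forall>m. lcoeff (fps_nth ?I k) m \<noteq> 0 \<longrightarrow> (\<forall>i. - int (c * k) \<le> m $ i)" if "k \<le> n" for k
    using that
  proof (induction k rule: less_induct)
    case (less k)
    show ?case
    proof (cases "k = 0")
      case True
      then show ?thesis by (auto simp: one_laurent.rep_eq)
    next
      case False
      show ?thesis
      proof (intro allI impI)
        fix m i assume nz: "lcoeff (fps_nth ?I k) m \<noteq> 0"
        have "fps_nth ?I k = - (\<Sum>j=1..k. fps_nth F j * fps_nth ?I (k - j))"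
          using False by (cases k) (simp_all add: sum_negf)
        with nz have "(\<Sum>j=1..k. lcoeff (fps_nth F j * fps_nth ?I (k - j)) m) \<noteq> 0"
          by (simp only: uminus_laurent.rep_eq lcoeff_sum)
        then obtain j where j: "1 \<le> j" "j \<le> k" "lcoeff (fps_nth F j * fps_nth ?I (k - j)) m \<noteq> 0"
          by (metis (no_types, lifting) atLeastAtMost_iff sum.neutral)
        have "{a. lcoeff (fps_nth F j) a \<noteq> 0 \<and> lcoeff (fps_nth ?I (k - j)) (m - a) \<noteq> 0} \<noteq> {}"
          using j(3) unfolding times_laurent.rep_eq by (metis sum.empty)
        then obtain a where a: "lcoeff (fps_nth F j) a \<noteq> 0"
            "lcoeff (fps_nth ?I (k - j)) (m - a) \<noteq> 0" by blast
        have "- int (c * j) \<le> a $ i" using lboundedD[OF F(1) _ a(1)] j less.prems by simp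
        moreover have "k - j < k" "k - j \<le> n" using j less.prems by auto
        then have "- int (c * (k - j)) \<le> (m - a) $ i" using less.IH a(2) by blast
        moreover have "int (c * k) = int (c * j) + int (c * (k - j))"
          using j(2) by (metis distrib_left le_add_diff_inverse of_nat_add)
        ultimately show "- int (c * k) \<le> m $ i" by simp
      qed
    qed
  qed
  then show ?thesis by (simp add: lbounded_def)
qed

lemma lapprox_right_inverse:
  assumes F: "lapprox c n L F G" "fps_nth F 0 = 1" "fps_nth G 0 = 1"
  shows "lapprox c n L (fps_right_inverse F 1) (fps_right_inverse G 1)"
proof -
  let ?I = "fps_right_inverse F 1" and ?J = "fps_right_inverse G 1"
  have "lbounded c n F" "lbounded c n G" using F(1) by (auto simp: lapprox_def)
  then have I: "lapprox c n L ?I ?I" and J: "lapprox c n L ?J ?J"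
    using lbounded_right_inverse F(2,3) by (auto simp: lapprox_refl)
  \<comment> \<open>Both inverses are compared with \<open>F\<^sup>-\<^sup>1 G\<^sup>-\<^sup>1\<close> times \<open>G\<close> or \<open>F\<close>.\<close>
  have "lapprox c n L (?I * (G * ?J)) (?I * (F * ?J))"
    by (intro lapprox_mult I J lapprox_sym[OF F(1)])
  moreover have "?I * (G * ?J) = ?I" by (simp only: fps_mult_right_inverse_1[OF F(3)] mult_1_right)
  moreover have "?I * (F * ?J) = (F * ?I) * ?J" by (simp only: mult_ac)
  then have "?I * (F * ?J) = ?J" by (simp only: fps_mult_right_inverse_1[OF F(2)] mult_1_left)
  ultimately show ?thesis by simp
qed

lemma lapprox_one: "lapprox c n L 1 1"
  by (simp add: lapprox_refl lbounded_one)

lemma lapprox_power: "lapprox c n L F G \<Longrightarrow> lapprox c n L (F ^ k) (G ^ k)"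
  by (induction k) (simp_all add: lapprox_one lapprox_mult)

lemma lapprox_zpow:
  "lapprox c n L F G \<Longrightarrow> fps_nth F 0 = 1 \<Longrightarrow> fps_nth G 0 = 1 \<Longrightarrow> lapprox c n L (fps_zpow F k) (fps_zpow G k)"
  by (simp add: fps_zpow_def lapprox_power lapprox_right_inverse)

lemma lapprox_prod:
  "(\<And>i. i \<in> S \<Longrightarrow> lapprox c n L (F i) (G i)) \<Longrightarrow> lapprox c n L (\<Prod>i\<in>S. F i) (\<Prod>i\<in>S. G i)"
  by (induction S rule: infinite_finite_induct) (simp_all add: lapprox_one lapprox_mult)

lemma lapprox_eq_fps:
  assumes "lbounded c n F" "\<And>k. k \<le> n \<Longrightarrow> fps_nth F k = fps_nth G k"
  shows "lapprox c n L F G"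
  using assms by (simp add: lapprox_def lbounded_def)

lemma lbounded_dilate_lsubst:
  assumes F: "lbounded c n F" and e: "0 < e"
  shows "lbounded c n (fps_dilate e (\<lambda>_. lsubst_pow e) F)"
  unfolding lbounded_def
proof (intro allI impI)
  fix k m i
  assume k: "k \<le> n" and nz: "lcoeff (fps_nth (fps_dilate e (\<lambda>_. lsubst_pow e) F) k) m \<noteq> 0"
  have ek: "e dvd k" using nz by (auto simp: fps_nth_dilate zero_laurent.rep_eq split: if_splits)
  then have em: "\<forall>i. int e dvd m $ i" and nz': "lcoeff (fps_nth F (k div e)) (\<chi> i. m $ i div int e) \<noteq> 0"
    using nz by (auto simp: fps_nth_dilate lsubst_pow.rep_eq split: if_splits)
  obtain j where j: "k = e * j" using ek by blast
  obtain l where l: "m $ i = int e * l" using em by blast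
  have "k div e \<le> n" using k by (meson div_le_dividend le_trans)
  from lboundedD[OF F this nz', of i] have "- int (c * j) \<le> l" using e by (simp add: j l)
  then have "int e * - int (c * j) \<le> int e * l" by (intro mult_left_mono) auto
  then show "- int (c * k) \<le> m $ i" by (simp add: j l algebra_simps)
qed

lemma lapprox_dilate_lsubst:
  assumes FG: "lapprox c n L F G" and e: "0 < e"
  shows "lapprox c n L (fps_dilate e (\<lambda>_. lsubst_pow e) F) (fps_dilate e (\<lambda>_. lsubst_pow e) G)"
proof -
  let ?D = "fps_dilate e (\<lambda>_. lsubst_pow e)"
  have "lcoeff (fps_nth (?D F) k) m = lcoeff (fps_nth (?D G) k) m"
    if k: "k \<le> n" and m: "\<forall>i. m $ i + int (c * k) \<le> int L" for k m
  proof (cases "e dvd k \<and> (\<forall>i. int e dvd m $ i)")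
    case True
    then obtain j where j: "k = e * j" by blast
    have "(m $ i div int e) + int (c * j) \<le> int L" for i
    proof -
      obtain l where l: "m $ i = int e * l" using True by blast
      have "int e * (l + int (c * j)) \<le> int L"
        using m[rule_format, of i] by (simp add: l j algebra_simps)
      moreover have "l + int (c * j) \<le> int e * (l + int (c * j))" if "0 \<le> l + int (c * j)"
        using that e by (simp add: mult_le_cancel_right1)
      ultimately have "l + int (c * j) \<le> int L" by linarith
      then show ?thesis using e by (simp add: l)
    qed
    moreover have "j \<le> e * j" using e by simp
    then have "j \<le> n" using k unfolding j by linarith
    ultimately have "lcoeff (fps_nth F j) (\<chi> i. m $ i div int e) = lcoeff (fps_nth G j) (\<chi> i. m $ i div int e)"
      using FG by (simp add: lapprox_def)
    then show ?thesis using e by (simp add: fps_nth_dilate lsubst_pow.rep_eq j)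
  next
    case False
    then show ?thesis by (auto simp: fps_nth_dilate lsubst_pow.rep_eq)
  qed
  with FG e show ?thesis by (simp add: lapprox_def lbounded_dilate_lsubst)
qed

section \<open>Frobenius orbits and the zeta function\<close>

text \<open>The closed points of degree at most \<open>n\<close>, as Frobenius orbits.\<close>
definition closed_points :: "('k::finite_field, 'p) atlas \<Rightarrow> nat \<Rightarrow> 'p set set"
  where "closed_points V n = {B \<in> frob_orbit V ` points V. card B \<le> n}"

context
  fixes V :: "('k::finite_field, 'p) atlas"
  assumes V: "variety V"
begin

lemma frob_funpow_points: "x \<in> points V \<Longrightarrow> (frob V ^^ k) x \<in> points V"
  by (induction k) (simp_all add: frob_chart(1)[OF V])

lemma frob_orbit_subset: "x \<in> points V \<Longrightarrow> frob_orbit V x \<subseteq> points V"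
  using frob_funpow_points by (auto simp: frob_orbit_def)

lemma self_in_frob_orbit: "x \<in> frob_orbit V x"
  unfolding frob_orbit_def by (metis funpow_0 rangeI)

lemma frob_orbit_period:
  assumes x: "x \<in> points V"
  shows finite_frob_orbit: "finite (frob_orbit V x)"
    and card_frob_orbit_pos: "0 < card (frob_orbit V x)"
    and frob_funpow_fixed_iff: "(frob V ^^ r) x = x \<longleftrightarrow> card (frob_orbit V x) dvd r"
proof -
  let ?f = "frob V"
  \<comment> \<open>The minimal period is the size of the orbit.\<close>
  define p where "p = (LEAST r. 0 < r \<and> (?f ^^ r) x = x)"
  have p: "0 < p" "(?f ^^ p) x = x"
    using LeastI_ex[OF frob_periodic[OF V x]] by (auto simp: p_def)
  have least: "p \<le> r" if "0 < r" "(?f ^^ r) x = x" for r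
    unfolding p_def using that by (intro Least_le) auto
  have "(?f ^^ (r mod p)) x = (?f ^^ r) x" for r
    using p(2) by (rule funpow_mod_eq)
  note mod = this
  have orb: "frob_orbit V x = (\<lambda>k. (?f ^^ k) x) ` {..<p}"
    unfolding frob_orbit_def using p(1) by (auto simp: image_iff) (metis mod mod_less_divisor lessThan_iff)
  have inj: "inj_on (\<lambda>k. (?f ^^ k) x) {..<p}"
  proof (rule linorder_inj_onI')
    fix i j assume ij: "i \<in> {..<p}" "j \<in> {..<p}" "i < j"
    show "(?f ^^ i) x \<noteq> (?f ^^ j) x"
    proof
      assume eq: "(?f ^^ i) x = (?f ^^ j) x"
      have "(?f ^^ (p - j + i)) x = (?f ^^ (p - j + j)) x"
        using eq by (simp only: funpow_add o_apply)
      also have "\<dots> = x" using ij p(2) by simp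
      finally have "p \<le> p - j + i" using ij by (intro least) auto
      with ij show False by auto
    qed
  qed
  have card: "card (frob_orbit V x) = p" using inj by (simp add: orb card_image)
  show "finite (frob_orbit V x)" by (simp add: orb)
  show "0 < card (frob_orbit V x)" using card p(1) by simp
  have "(?f ^^ r) x = x \<longleftrightarrow> (?f ^^ (r mod p)) x = x" by (simp add: mod)
  also have "\<dots> \<longleftrightarrow> r mod p = 0"
    using least[of "r mod p"] mod_less_divisor[OF p(1), of r] by (cases "r mod p = 0") auto
  finally show "(?f ^^ r) x = x \<longleftrightarrow> card (frob_orbit V x) dvd r" by (simp add: card dvd_eq_mod_eq_0)
qed

lemma frob_orbit_eq:
  assumes x: "x \<in> points V" and y: "y \<in> frob_orbit V x"
  shows "frob_orbit V y = frob_orbit V x"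
proof -
  have sub: "frob_orbit V b \<subseteq> frob_orbit V a" if b: "b \<in> frob_orbit V a" for a b
  proof -
    obtain k where "b = (frob V ^^ k) a" using b unfolding frob_orbit_def by blast
    then have "(frob V ^^ j) b = (frob V ^^ (j + k)) a" for j by (simp add: funpow_add)
    then show ?thesis by (auto simp: frob_orbit_def)
  qed
  obtain k where k: "y = (frob V ^^ k) x" using y unfolding frob_orbit_def by blast
  let ?c = "card (frob_orbit V x)"
  \<comment> \<open>Going on from \<open>y\<close> up to a multiple of the period leads back to \<open>x\<close>.\<close>
  have "k \<le> k * ?c" using card_frob_orbit_pos[OF x] by simp
  then have "(frob V ^^ (k * ?c - k)) y = (frob V ^^ (k * ?c)) x"
    by (simp add: k flip: funpow_add comp_apply[of "frob V ^^ _" "frob V ^^ _"])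
  also have "\<dots> = x" using frob_funpow_fixed_iff[OF x] by simp
  finally have "x \<in> frob_orbit V y" unfolding frob_orbit_def by (metis rangeI)
  with sub y show ?thesis by blast
qed

lemma frob_orbits_disjoint:
  assumes "A \<in> frob_orbit V ` points V" "B \<in> frob_orbit V ` points V" "x \<in> A" "x \<in> B"
  shows "A = B"
  using assms frob_orbit_eq by (metis imageE)

lemma finite_closed_points: "finite (closed_points V n)"
proof (rule finite_subset)
  show "closed_points V n \<subseteq> frob_orbit V ` (\<Union>r\<in>{1..n}. rational_points V r)"
  proof
    fix B assume "B \<in> closed_points V n"
    then obtain x where x: "x \<in> points V" "B = frob_orbit V x" "card B \<le> n"
      by (auto simp: closed_points_def)
    have "x \<in> rational_points V (card B)" "card B \<in> {1..n}"
      using x frob_funpow_fixed_iff[OF x(1)] card_frob_orbit_pos[OF x(1)]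
      by (auto simp: rational_points_eq_fixed[OF V])
    with x(2) show "B \<in> frob_orbit V ` (\<Union>r\<in>{1..n}. rational_points V r)" by blast
  qed
  show "finite (frob_orbit V ` (\<Union>r\<in>{1..n}. rational_points V r))"
    by (intro finite_imageI finite_UN_I) (auto intro: finite_rational_points[OF V])
qed

lemma frob_orbit_closed_point:
  assumes B: "B \<in> closed_points V n" and x: "x \<in> B"
  shows "frob_orbit V x = B"
proof -
  obtain z where "z \<in> points V" "B = frob_orbit V z" using B by (auto simp: closed_points_def)
  then show ?thesis using frob_orbit_eq x by simp
qed

lemma closed_point_card_pos: "B \<in> closed_points V n \<Longrightarrow> 0 < card B"
  using card_frob_orbit_pos by (auto simp: closed_points_def)

text \<open>A closed point of degree \<open>d\<close> accounts for \<open>d\<close> points over the extension of degree \<open>r\<close> if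
  \<open>d\<close> divides \<open>r\<close>, and for none otherwise.\<close>
lemma card_rational_points:
  assumes r: "0 < r" "r \<le> n"
  shows "card (rational_points V r) = (\<Sum>B\<in>closed_points V n. if card B dvd r then card B else 0)"
proof -
  let ?O = "{B \<in> closed_points V n. card B dvd r}"
  have "rational_points V r = \<Union> ?O"
  proof safe
    fix x assume "x \<in> rational_points V r"
    then have x: "x \<in> points V" "card (frob_orbit V x) dvd r"
      using frob_funpow_fixed_iff by (auto simp: rational_points_eq_fixed[OF V])
    then have "frob_orbit V x \<in> ?O" using r dvd_imp_le[OF x(2)] by (auto simp: closed_points_def)
    then show "x \<in> \<Union> ?O" using self_in_frob_orbit by blast
  next
    fix x B assume B: "x \<in> B" "B \<in> closed_points V n" "card B dvd r"
    then obtain y where y: "y \<in> points V" "B = frob_orbit V y" by (auto simp: closed_points_def)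
    have "x \<in> points V" using frob_orbit_subset y B(1) by blast
    moreover have "B = frob_orbit V x" using frob_orbit_eq y B(1) by simp
    ultimately show "x \<in> rational_points V r"
      using B(3) frob_funpow_fixed_iff by (simp add: rational_points_eq_fixed[OF V])
  qed
  also have "card (\<Union> ?O) = (\<Sum>B\<in>?O. card B)"
  proof (rule card_Union_disjoint)
    show "pairwise disjnt ?O"
      unfolding pairwise_def disjnt_def closed_points_def using frob_orbits_disjoint by blast
    show "finite B" if "B \<in> ?O" for B
      using that finite_frob_orbit by (auto simp: closed_points_def)
  qed
  also have "\<dots> = (\<Sum>B\<in>closed_points V n. if card B dvd r then card B else 0)"
    by (rule sum.inter_filter[OF finite_closed_points])
  finally show ?thesis .
qed

end

lemma inverse_one_minus_X_power:
  assumes "0 < b"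
  shows "inverse (1 - fps_X ^ b) = (Abs_fps (\<lambda>r. if b dvd r then 1 else 0) :: rat fps)"
proof -
  let ?g = "Abs_fps (\<lambda>r. if b dvd r then 1 else 0) :: rat fps"
  have "(1 - fps_X ^ b) * ?g = 1"
  proof (rule fps_ext)
    fix r
    have "b dvd r - b \<longleftrightarrow> b dvd r" if "b \<le> r" using that by (metis dvd_minus_self not_le)
    then show "fps_nth ((1 - fps_X ^ b) * ?g) r = fps_nth 1 r"
      using assms by (auto simp: algebra_simps fps_X_power_mult_nth dest: dvd_imp_le)
  qed
  then show ?thesis by (rule fps_inverse_unique)
qed

text \<open>The logarithmic derivative of a finite Euler product.\<close>
lemma X_mult_deriv_euler_product:
  assumes "finite S" "\<And>i. i \<in> S \<Longrightarrow> 0 < b i"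
  shows "fps_X * fps_deriv (\<Prod>i\<in>S. inverse (1 - fps_X ^ b i) :: rat fps)
    = (\<Prod>i\<in>S. inverse (1 - fps_X ^ b i))
      * Abs_fps (\<lambda>r. if r = 0 then 0 else of_nat (\<Sum>i\<in>S. if b i dvd r then b i else 0))"
  using assms
proof (induction S rule: finite_induct)
  case empty
  show ?case by (simp add: fps_eq_iff)
next
  case (insert i S)
  let ?P = "\<Prod>i\<in>S. inverse (1 - fps_X ^ b i) :: rat fps"
  let ?H = "\<lambda>S. Abs_fps (\<lambda>r. if r = 0 then 0 else of_nat (\<Sum>i\<in>S. if b i dvd r then b i else 0)) :: rat fps"
  let ?g = "inverse (1 - fps_X ^ b i) :: rat fps"
  have b: "0 < b i" using insert by auto
  have "fps_deriv ?g = - fps_deriv (1 - fps_X ^ b i) * ?g\<^sup>2"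
    using b by (intro fps_inverse_deriv) simp
  also have "fps_deriv (1 - fps_X ^ b i :: rat fps) = - (of_nat (b i) * fps_X ^ (b i - 1))"
    by (simp add: fps_deriv_power fps_of_nat)
  finally have "fps_X * fps_deriv ?g = of_nat (b i) * (fps_X * fps_X ^ (b i - 1)) * ?g\<^sup>2"
    by (simp add: mult_ac)
  also have "fps_X * fps_X ^ (b i - 1) = (fps_X ^ b i :: rat fps)"
    using b by (simp flip: power_Suc)
  also have "of_nat (b i) * fps_X ^ b i * ?g\<^sup>2 = ?g * (of_nat (b i) * (fps_X ^ b i * ?g))"
    by (simp add: power2_eq_square mult_ac)
  also have "fps_X ^ b i * ?g = Abs_fps (\<lambda>r. if b i dvd r \<and> r \<noteq> 0 then 1 else 0)"
  proof -
    have "(1 - fps_X ^ b i) * ?g = 1" using b by (intro inverse_mult_eq_1') simp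
    then have "fps_X ^ b i * ?g = ?g - 1" by (simp add: algebra_simps)
    then show ?thesis using b by (auto simp: fps_eq_iff inverse_one_minus_X_power)
  qed
  finally have g: "fps_X * fps_deriv ?g = ?g * (of_nat (b i) * Abs_fps (\<lambda>r. if b i dvd r \<and> r \<noteq> 0 then 1 else 0))" .
  have H: "?H (insert i S) = of_nat (b i) * Abs_fps (\<lambda>r. if b i dvd r \<and> r \<noteq> 0 then 1 else 0) + ?H S"
    using insert.hyps by (auto simp: fps_eq_iff simp flip: fps_of_nat)
  have "fps_X * fps_deriv (\<Prod>i\<in>insert i S. inverse (1 - fps_X ^ b i) :: rat fps)
      = (fps_X * fps_deriv ?g) * ?P + ?g * (fps_X * fps_deriv ?P)"
    using insert.hyps by (simp add: algebra_simps)
  also have "fps_X * fps_deriv ?P = ?P * ?H S"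
    using insert by simp
  finally show ?case using insert.hyps unfolding H g by (simp add: algebra_simps)
qed

text \<open>A series is determined up to \<open>X\<^sup>n\<close> by its constant term and its logarithmic derivative up to \<open>X\<^sup>n\<close>.\<close>
lemma fps_log_deriv_unique:
  fixes F G H K :: "'a::field_char_0 fps"
  assumes F: "fps_X * fps_deriv F = F * H" and G: "fps_X * fps_deriv G = G * K"
    and 0: "fps_nth F 0 = fps_nth G 0" "fps_nth H 0 = 0"
    and HK: "\<And>r. r \<le> n \<Longrightarrow> fps_nth H r = fps_nth K r"
    and k: "k \<le> n"
  shows "fps_nth F k = fps_nth G k"
  using k
proof (induction k rule: less_induct)
  case (less k)
  show ?case
  proof (cases "k = 0")
    case True
    with 0 show ?thesis by simp
  next
    case False
    have co: "of_nat k * fps_nth P k = fps_nth (fps_X * fps_deriv P) k" for P :: "'a fps"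
      using False by (cases k) auto
    have "of_nat k * fps_nth F k = (\<Sum>i=0..k. fps_nth F i * fps_nth H (k - i))"
      by (simp add: co F fps_mult_nth)
    also have "\<dots> = (\<Sum>i=0..k. fps_nth G i * fps_nth K (k - i))"
    proof (rule sum.cong)
      fix i assume i: "i \<in> {0..k}"
      show "fps_nth F i * fps_nth H (k - i) = fps_nth G i * fps_nth K (k - i)"
      proof (cases "i = k")
        case True
        then show ?thesis using 0(2) HK[of 0] by simp
      next
        case False
        then show ?thesis using i less HK[of "k - i"] by simp
      qed
    qed simp
    also have "\<dots> = of_nat k * fps_nth G k"
      by (simp add: co G fps_mult_nth)
    finally show ?thesis using False by simp
  qed
qed

text \<open>The finite Euler product over the closed points of degree at most \<open>n\<close>.\<close>
definition euler_product :: "('k::finite_field, 'p) atlas \<Rightarrow> nat \<Rightarrow> int fps"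
  where "euler_product V n = (\<Prod>B\<in>closed_points V n. fps_right_inverse (1 - fps_X ^ card B) 1)"

lemma of_int_fps_euler_product:
  fixes V :: "('k::finite_field, 'p) atlas"
  assumes V: "variety V"
  shows "of_int_fps (euler_product V n) = (\<Prod>B\<in>closed_points V n. inverse (1 - fps_X ^ card B) :: rat fps)"
proof -
  interpret graded_hom "\<lambda>_. of_int :: int \<Rightarrow> rat" by (rule graded_hom_of_int)
  have "fps_dilate 1 (\<lambda>_. of_int) (fps_right_inverse (1 - fps_X ^ card B) 1)
      = (inverse (1 - fps_X ^ card B) :: rat fps)" if "B \<in> closed_points V n" for B
  proof -
    have "0 < card B" using closed_point_card_pos[OF V that] .
    moreover have "fps_dilate 1 (\<lambda>_. of_int) (fps_X ^ card B) = (fps_X ^ card B :: rat fps)"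
      by (auto simp: fps_eq_iff fps_nth_dilate)
    ultimately show ?thesis
      by (subst dilate_right_inverse) (simp_all add: dilate_diff dilate_one fps_inverse_def)
  qed
  then show ?thesis by (simp add: of_int_fps_conv_dilate euler_product_def dilate_prod)
qed

text \<open>
  Both sides have constant term \<open>1\<close>, and their logarithmic derivatives agree up to \<open>T\<^sup>n\<close> by the
  count of rational points.
\<close>
lemma zeta_eq_euler_product:
  fixes V :: "('k::finite_field, 'p) atlas"
  assumes V: "variety V" and k: "k \<le> n"
  shows "fps_nth (zeta V) k = of_int (fps_nth (euler_product V n) k)"
proof -
  let ?G = "Abs_fps (\<lambda>r. if r = 0 then 0 else of_nat (card (rational_points V r)) / of_nat r) :: rat fps"
  let ?P = "\<Prod>B\<in>closed_points V n. inverse (1 - fps_X ^ card B) :: rat fps"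
  have zeta: "fps_X * fps_deriv (zeta V) = zeta V * (fps_X * fps_deriv ?G)"
    unfolding zeta_def by (subst fps_compose_deriv) (simp_all add: mult_ac)
  have eu: "fps_X * fps_deriv ?P = ?P * Abs_fps (\<lambda>r. if r = 0 then 0
      else of_nat (\<Sum>B\<in>closed_points V n. if card B dvd r then card B else 0))"
    by (rule X_mult_deriv_euler_product[OF finite_closed_points[OF V] closed_point_card_pos[OF V]])
  have "fps_nth (zeta V) k = fps_nth ?P k"
  proof (rule fps_log_deriv_unique[OF zeta eu _ _ _ k])
    have "fps_nth ?P 0 = 1"
      by (rule fps_nth_0_prod_1) (use closed_point_card_pos[OF V] in auto)
    then show "fps_nth (zeta V) 0 = fps_nth ?P 0" by (simp add: zeta_def)
    fix r assume "r \<le> n"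
    then show "fps_nth (fps_X * fps_deriv ?G) r = fps_nth (Abs_fps (\<lambda>r. if r = 0 then 0
      else of_nat (\<Sum>B\<in>closed_points V n. if card B dvd r then card B else 0))) r"
      using card_rational_points[OF V, of r n] by (cases r) auto
  qed simp
  also have "?P = of_int_fps (euler_product V n)" using of_int_fps_euler_product[OF V] by simp
  finally show ?thesis by (simp add: of_int_fps_def)
qed

text \<open>
  The zeta function with its integer coefficients: closed points of degree greater than \<open>n\<close> do
  not affect the coefficient of \<open>T\<^sup>n\<close>.
\<close>
definition int_zeta :: "('k::finite_field, 'p) atlas \<Rightarrow> int fps"
  where "int_zeta V = Abs_fps (\<lambda>n. fps_nth (euler_product V n) n)"

lemma of_int_fps_int_zeta: "variety V \<Longrightarrow> of_int_fps (int_zeta V) = zeta V"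
  using zeta_eq_euler_product[of V n n for n] by (simp add: fps_eq_iff of_int_fps_def int_zeta_def)

lemma int_zeta_eq_euler_product:
  assumes "variety V" "k \<le> n"
  shows "fps_nth (int_zeta V) k = fps_nth (euler_product V n) k"
  using zeta_eq_euler_product[OF assms] zeta_eq_euler_product[OF assms(1), of k k]
  by (simp add: int_zeta_def)

section \<open>The coloring zeta function as an Euler product\<close>

lemma fps_nth_prod_cong:
  assumes "\<And>i k. i \<in> S \<Longrightarrow> k \<le> n \<Longrightarrow> fps_nth (F i) k = fps_nth (G i) k" "k \<le> n"
  shows "fps_nth (\<Prod>i\<in>S. F i) k = fps_nth (\<Prod>i\<in>S. G i :: 'a::comm_ring_1 fps) k"
  using assms
proof (induction S arbitrary: k rule: infinite_finite_induct)
  case (insert i S)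
  then show ?case by (auto simp: fps_mult_nth intro!: sum.cong)
qed auto

lemma prod_fps_const_X_power:
  "(\<Prod>i\<in>S. fps_const (a i) * fps_X ^ b i) = fps_const (\<Prod>i\<in>S. a i :: 'a::comm_ring_1) * fps_X ^ (\<Sum>i\<in>S. b i)"
  by (induction S rule: infinite_finite_induct) (simp_all add: power_add mult_ac flip: fps_const_mult)

lemma zero_color_props:
  assumes "valid_coloring_data C"
  shows "cdeg C (zero_color C) = 0" and "weight C (zero_color C) = 1"
    and cdeg_pos: "c \<noteq> zero_color C \<Longrightarrow> 0 < cdeg C c"
  using assms by (auto simp: valid_coloring_data_def)

lemma finite_colors_le:
  assumes "valid_coloring_data C"
  shows "finite {c. cdeg C c \<le> n}"
proof -
  have "{c. cdeg C c \<le> n} = (\<Union>k\<le>n. {c. cdeg C c = k})" by auto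
  then show ?thesis using assms by (simp add: valid_coloring_data_def)
qed

context
  fixes V :: "('k::finite_field, 'p) atlas" and C :: "('c, 'n::finite) coloring_data"
  assumes V: "variety V" and C: "valid_coloring_data C"
begin

lemma coloring_frob_orbit:
  assumes L: "\<Lambda> \<in> colorings V C" and x: "x \<in> points V" and y: "y \<in> frob_orbit V x"
  shows "\<Lambda> y = \<Lambda> x"
proof -
  have "\<Lambda> ((frob V ^^ k) x) = \<Lambda> x" for k
  proof (induction k)
    case (Suc k)
    have "(frob V ^^ k) x \<in> points V" using frob_funpow_points[OF V x] .
    with L Suc show ?case by (simp add: colorings_def)
  qed simp
  with y show ?thesis by (auto simp: frob_orbit_def)
qed

lemma the_elem_coloring:
  assumes L: "\<Lambda> \<in> colorings V C" and B: "B \<in> frob_orbit V ` points V" and x: "x \<in> B"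
  shows "the_elem (\<Lambda> ` B) = \<Lambda> x"
proof -
  obtain z where z: "z \<in> points V" "B = frob_orbit V z" using B by blast
  have "\<Lambda> ` B = {\<Lambda> x}" using coloring_frob_orbit[OF L z(1)] x z(2) by auto
  then show ?thesis by simp
qed

lemma coloring_degree_eq:
  assumes L: "\<Lambda> \<in> colorings V C" and supp: "csupp V C \<Lambda> \<subseteq> \<Union> (closed_points V n)"
  shows "coloring_degree V C \<Lambda> = (\<Sum>B\<in>closed_points V n. card B * cdeg C (the_elem (\<Lambda> ` B)))"
proof -
  have fin: "finite B" and pts: "B \<subseteq> points V" if "B \<in> closed_points V n" for B
    using that finite_frob_orbit[OF V] frob_orbit_subset[OF V] by (auto simp: closed_points_def)
  have "coloring_degree V C \<Lambda> = (\<Sum>x\<in>\<Union> (closed_points V n). cdeg C (\<Lambda> x))"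
    unfolding coloring_degree_def
  proof (rule sum.mono_neutral_left)
    show "finite (\<Union> (closed_points V n))" using finite_closed_points[OF V] fin by auto
    show "\<forall>x\<in>\<Union> (closed_points V n) - csupp V C \<Lambda>. cdeg C (\<Lambda> x) = 0"
      using pts zero_color_props[OF C] by (auto simp: csupp_def)
  qed (rule supp)
  also have "\<dots> = (\<Sum>B\<in>closed_points V n. \<Sum>x\<in>B. cdeg C (\<Lambda> x))"
  proof (subst sum.Union_disjoint)
    show "\<forall>A\<in>closed_points V n. \<forall>B\<in>closed_points V n. A \<noteq> B \<longrightarrow> A \<inter> B = {}"
      unfolding closed_points_def using frob_orbits_disjoint[OF V] by blast
  qed (use fin in auto)
  also have "\<dots> = (\<Sum>B\<in>closed_points V n. card B * cdeg C (the_elem (\<Lambda> ` B)))"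
  proof (rule sum.cong)
    fix B assume "B \<in> closed_points V n"
    then have "(\<Sum>x\<in>B. cdeg C (\<Lambda> x)) = (\<Sum>x\<in>B. cdeg C (the_elem (\<Lambda> ` B)))"
      using the_elem_coloring[OF L] by (intro sum.cong) (auto simp: closed_points_def)
    then show "(\<Sum>x\<in>B. cdeg C (\<Lambda> x)) = card B * cdeg C (the_elem (\<Lambda> ` B))" by simp
  qed simp
  finally show ?thesis .
qed

lemma coloring_weight_eq:
  assumes L: "\<Lambda> \<in> colorings V C" and supp: "csupp V C \<Lambda> \<subseteq> \<Union> (closed_points V n)"
  shows "coloring_weight V C \<Lambda>
    = (\<Prod>B\<in>closed_points V n. lsubst_pow (card B) (weight C (the_elem (\<Lambda> ` B))))"
  unfolding coloring_weight_def
proof (rule prod.mono_neutral_left)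
  show "finite (closed_points V n)" by (rule finite_closed_points[OF V])
  show "frob_orbit V ` csupp V C \<Lambda> \<subseteq> closed_points V n"
  proof
    fix B assume "B \<in> frob_orbit V ` csupp V C \<Lambda>"
    then obtain x where x: "x \<in> csupp V C \<Lambda>" "B = frob_orbit V x" by blast
    then obtain A where A: "A \<in> closed_points V n" "x \<in> A" using supp by blast
    then show "B \<in> closed_points V n"
      using x(2) frob_orbit_closed_point[OF V A] by simp
  qed
  show "\<forall>B\<in>closed_points V n - frob_orbit V ` csupp V C \<Lambda>.
      lsubst_pow (card B) (weight C (the_elem (\<Lambda> ` B))) = 1"
  proof
    fix B assume B: "B \<in> closed_points V n - frob_orbit V ` csupp V C \<Lambda>"
    then obtain x where x: "x \<in> points V" "B = frob_orbit V x" by (auto simp: closed_points_def)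
    with B have "\<Lambda> x = zero_color C" by (auto simp: csupp_def)
    moreover have "the_elem (\<Lambda> ` B) = \<Lambda> x"
      using x self_in_frob_orbit[OF V, of x] by (intro the_elem_coloring[OF L]) auto
    moreover have "0 < card B" using B closed_point_card_pos[OF V] by blast
    ultimately show "lsubst_pow (card B) (weight C (the_elem (\<Lambda> ` B))) = 1"
      by (simp add: zero_color_props[OF C] lsubst_pow_one)
  qed
qed

text \<open>In a coloring of degree at most \<open>n\<close> every colored point and every color has degree at most \<open>n\<close>.\<close>
lemma coloring_support_le:
  assumes L: "\<Lambda> \<in> colorings V C" and deg: "coloring_degree V C \<Lambda> \<le> n"
  shows "csupp V C \<Lambda> \<subseteq> \<Union> (closed_points V n)" and "x \<in> points V \<Longrightarrow> cdeg C (\<Lambda> x) \<le> n"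
proof -
  have fin: "finite (csupp V C \<Lambda>)" using L by (simp add: colorings_def)
  show "csupp V C \<Lambda> \<subseteq> \<Union> (closed_points V n)"
  proof
    fix x assume x: "x \<in> csupp V C \<Lambda>"
    then have xp: "x \<in> points V" by (simp add: csupp_def)
    have sub: "frob_orbit V x \<subseteq> csupp V C \<Lambda>"
      using coloring_frob_orbit[OF L xp] frob_orbit_subset[OF V xp] x by (auto simp: csupp_def)
    have "card (frob_orbit V x) \<le> card (csupp V C \<Lambda>)" by (rule card_mono[OF fin sub])
    also have "\<dots> = (\<Sum>y\<in>csupp V C \<Lambda>. 1)" by simp
    also have "\<dots> \<le> coloring_degree V C \<Lambda>"
      unfolding coloring_degree_def using cdeg_pos[OF C] by (intro sum_mono) (auto simp: csupp_def Suc_le_eq)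
    finally have "frob_orbit V x \<in> closed_points V n" using deg xp by (simp add: closed_points_def)
    then show "x \<in> \<Union> (closed_points V n)" using self_in_frob_orbit[OF V] by blast
  qed
  show "cdeg C (\<Lambda> x) \<le> n" if "x \<in> points V"
  proof (cases "x \<in> csupp V C \<Lambda>")
    case True
    then have "cdeg C (\<Lambda> x) \<le> coloring_degree V C \<Lambda>"
      unfolding coloring_degree_def using fin by (intro member_le_sum) auto
    with deg show ?thesis by simp
  next
    case False
    with that show ?thesis by (simp add: csupp_def zero_color_props[OF C])
  qed
qed

text \<open>The coloring with prescribed colors of the closed points of degree at most \<open>n\<close> and color \<open>0\<close> elsewhere.\<close>
definition coloring_of :: "nat \<Rightarrow> ('p set \<Rightarrow> 'c) \<Rightarrow> 'p \<Rightarrow> 'c"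
  where "coloring_of n g = (\<lambda>x\<in>points V.
    if frob_orbit V x \<in> closed_points V n then g (frob_orbit V x) else zero_color C)"

lemma coloring_of_supp: "csupp V C (coloring_of n g) \<subseteq> \<Union> (closed_points V n)"
  using self_in_frob_orbit[OF V] by (auto simp: csupp_def coloring_of_def split: if_splits)

lemma coloring_of_in: "coloring_of n g \<in> colorings V C"
proof -
  have "finite (\<Union> (closed_points V n))"
    using finite_closed_points[OF V] finite_frob_orbit[OF V] by (auto simp: closed_points_def)
  then have "finite (csupp V C (coloring_of n g))" using coloring_of_supp finite_subset by blast
  moreover have "frob_orbit V (frob V x) = frob_orbit V x" if "x \<in> points V" for x
  proof (rule frob_orbit_eq[OF V that])
    have "frob V x = (frob V ^^ 1) x" by simp
    then show "frob V x \<in> frob_orbit V x" unfolding frob_orbit_def by blast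
  qed
  ultimately show ?thesis
    using frob_chart(1)[OF V] by (auto simp: colorings_def coloring_of_def)
qed

lemma the_elem_coloring_of:
  assumes "B \<in> closed_points V n"
  shows "the_elem (coloring_of n g ` B) = g B"
proof -
  obtain x where x: "x \<in> points V" "B = frob_orbit V x" using assms by (auto simp: closed_points_def)
  then have "the_elem (coloring_of n g ` B) = coloring_of n g x"
    using self_in_frob_orbit[OF V] by (intro the_elem_coloring[OF coloring_of_in]) auto
  with x assms show ?thesis by (simp add: coloring_of_def)
qed

lemma coloring_of_the_elem:
  assumes L: "\<Lambda> \<in> colorings V C" and supp: "csupp V C \<Lambda> \<subseteq> \<Union> (closed_points V n)"
  shows "coloring_of n (\<lambda>B\<in>closed_points V n. the_elem (\<Lambda> ` B)) = \<Lambda>"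
proof
  fix x
  show "coloring_of n (\<lambda>B\<in>closed_points V n. the_elem (\<Lambda> ` B)) x = \<Lambda> x"
  proof (cases "x \<in> points V")
    case True
    show ?thesis
    proof (cases "frob_orbit V x \<in> closed_points V n")
      case t: True
      have "the_elem (\<Lambda> ` frob_orbit V x) = \<Lambda> x"
        using True self_in_frob_orbit[OF V] by (intro the_elem_coloring[OF L]) auto
      with t True show ?thesis by (simp add: coloring_of_def)
    next
      case False
      have "x \<notin> csupp V C \<Lambda>"
      proof
        assume "x \<in> csupp V C \<Lambda>"
        then obtain A where "A \<in> closed_points V n" "x \<in> A" using supp by blast
        then show False using False frob_orbit_closed_point[OF V] by simp
      qed
      with False True show ?thesis by (simp add: coloring_of_def csupp_def)
    qed
  next
    case False
    with L show ?thesis by (simp add: coloring_of_def colorings_def extensional_def)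
  qed
qed

text \<open>
  A coloring of degree at most \<open>n\<close> amounts to a choice of a color for every closed point of degree
  at most \<open>n\<close>.
\<close>
lemma fps_nth_coloring_zeta:
  assumes k: "k \<le> n"
  shows "fps_nth (coloring_zeta V C) k
    = (\<Sum>g | g \<in> PiE (closed_points V n) (\<lambda>_. {c. cdeg C c \<le> n})
              \<and> (\<Sum>B\<in>closed_points V n. card B * cdeg C (g B)) = k.
        \<Prod>B\<in>closed_points V n. lsubst_pow (card B) (weight C (g B)))"
proof -
  let ?O = "closed_points V n"
  let ?j = "\<lambda>\<Lambda>. \<lambda>B\<in>?O. the_elem (\<Lambda> ` B)"
  have "(\<Sum>\<Lambda> | \<Lambda> \<in> colorings V C \<and> coloring_degree V C \<Lambda> = k. coloring_weight V C \<Lambda>)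
    = (\<Sum>g | g \<in> PiE ?O (\<lambda>_. {c. cdeg C c \<le> n}) \<and> (\<Sum>B\<in>?O. card B * cdeg C (g B)) = k.
        \<Prod>B\<in>?O. lsubst_pow (card B) (weight C (g B)))"
  proof (rule sum.reindex_bij_witness[of _ "coloring_of n" ?j])
    fix \<Lambda> assume "\<Lambda> \<in> {\<Lambda>. \<Lambda> \<in> colorings V C \<and> coloring_degree V C \<Lambda> = k}"
    then have L: "\<Lambda> \<in> colorings V C" and deg: "coloring_degree V C \<Lambda> = k" by auto
    have "coloring_degree V C \<Lambda> \<le> n" using deg k by simp
    note supp = coloring_support_le[OF L this]
    show "coloring_of n (?j \<Lambda>) = \<Lambda>" by (rule coloring_of_the_elem[OF L supp(1)])
    have "?j \<Lambda> B \<in> {c. cdeg C c \<le> n}" if B: "B \<in> ?O" for B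
    proof -
      obtain x where x: "x \<in> points V" "B = frob_orbit V x" using B by (auto simp: closed_points_def)
      then have "the_elem (\<Lambda> ` B) = \<Lambda> x"
        using self_in_frob_orbit[OF V] by (intro the_elem_coloring[OF L]) auto
      with supp(2)[OF x(1)] B show ?thesis by simp
    qed
    moreover have "(\<Sum>B\<in>?O. card B * cdeg C (?j \<Lambda> B)) = k"
      using coloring_degree_eq[OF L supp(1)] deg by simp
    ultimately show "?j \<Lambda> \<in> {g. g \<in> PiE ?O (\<lambda>_. {c. cdeg C c \<le> n}) \<and>
        (\<Sum>B\<in>?O. card B * cdeg C (g B)) = k}"
      by (simp add: PiE_iff)
    show "(\<Prod>B\<in>?O. lsubst_pow (card B) (weight C (?j \<Lambda> B))) = coloring_weight V C \<Lambda>"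
      using coloring_weight_eq[OF L supp(1)] by simp
  next
    fix g assume g: "g \<in> {g. g \<in> PiE ?O (\<lambda>_. {c. cdeg C c \<le> n}) \<and>
        (\<Sum>B\<in>?O. card B * cdeg C (g B)) = k}"
    have "?j (coloring_of n g) B = g B" for B
      using g by (cases "B \<in> ?O") (auto simp: the_elem_coloring_of PiE_iff extensional_def)
    then show "?j (coloring_of n g) = g" by blast
    show "coloring_of n g \<in> {\<Lambda>. \<Lambda> \<in> colorings V C \<and> coloring_degree V C \<Lambda> = k}"
      using g by (simp add: coloring_of_in coloring_degree_eq[OF coloring_of_in coloring_of_supp]
          the_elem_coloring_of)
  qed
  then show ?thesis by (simp add: coloring_zeta_def)
qed

text \<open>
  The Euler product: each closed point \<open>B\<close> contributes the series of the one-point variety with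
  \<open>t\<close> and \<open>T\<close> raised to the power \<open>|B|\<close>.
\<close>
lemma coloring_zeta_euler_product:
  assumes k: "k \<le> n"
  shows "fps_nth (coloring_zeta V C) k = fps_nth (\<Prod>B\<in>closed_points V n.
    fps_dilate (card B) (\<lambda>_. lsubst_pow (card B)) (coloring_zeta (point_variety :: ('k, unit) atlas) C)) k"
proof -
  let ?P = "coloring_zeta (point_variety :: ('k, unit) atlas) C"
  let ?CC = "{c. cdeg C c \<le> n}"
  let ?O = "closed_points V n"
  \<comment> \<open>Only finitely many colors matter up to \<open>T\<^sup>n\<close>, so that the product of sums can be expanded.\<close>
  define A where "A = (\<lambda>(B :: 'p set) c. fps_const (lsubst_pow (card B) (weight C c)) * fps_X ^ (card B * cdeg C c))"
  have trunc: "fps_nth (fps_dilate (card B) (\<lambda>_. lsubst_pow (card B)) ?P) j = fps_nth (\<Sum>c\<in>?CC. A B c) j"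
    if B: "B \<in> ?O" and j: "j \<le> n" for B :: "'p set" and j
  proof -
    have pos: "0 < card B" using closed_point_card_pos[OF V B] .
    interpret graded_hom "\<lambda>_. lsubst_pow (card B)" by (rule graded_hom_lsubst_pow[OF pos])
    have "fps_nth (\<Sum>c\<in>?CC. A B c) j = (\<Sum>c\<in>?CC. if j = card B * cdeg C c then lsubst_pow (card B) (weight C c) else 0)"
      by (auto simp: fps_sum_nth A_def intro!: sum.cong)
    also have "\<dots> = (\<Sum>c | c \<in> ?CC \<and> j = card B * cdeg C c. lsubst_pow (card B) (weight C c))"
      using finite_colors_le[OF C, of n] by (rule sum.inter_filter[symmetric])
    also have "\<dots> = fps_nth (fps_dilate (card B) (\<lambda>_. lsubst_pow (card B)) ?P) j"
    proof (cases "card B dvd j")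
      case True
      then obtain l where l: "j = card B * l" by blast
      have "l \<le> card B * l" using pos by simp
      then have "l \<le> n" using j unfolding l by linarith
      then have "{c. c \<in> ?CC \<and> j = card B * cdeg C c} = {c. cdeg C c = l}"
        using pos by (auto simp: l)
      then show ?thesis using pos by (simp add: l fps_nth_dilate coloring_zeta_point[OF C] hom_sum)
    next
      case False
      then have "{c. c \<in> ?CC \<and> j = card B * cdeg C c} = {}" by auto
      with False show ?thesis by (simp add: fps_nth_dilate del: Collect_empty_eq) 
    qed
    finally show ?thesis by simp
  qed
  have "fps_nth (\<Prod>B\<in>?O. fps_dilate (card B) (\<lambda>_. lsubst_pow (card B)) ?P) k = fps_nth (\<Prod>B\<in>?O. \<Sum>c\<in>?CC. A B c) k"
    by (rule fps_nth_prod_cong[OF trunc k])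
  also have "(\<Prod>B\<in>?O. \<Sum>c\<in>?CC. A B c) = (\<Sum>g\<in>PiE ?O (\<lambda>_. ?CC). \<Prod>B\<in>?O. A B (g B))"
    by (rule prod_sum_PiE) (simp_all add: finite_closed_points[OF V] finite_colors_le[OF C])
  also have "fps_nth \<dots> k = (\<Sum>g\<in>PiE ?O (\<lambda>_. ?CC). if (\<Sum>B\<in>?O. card B * cdeg C (g B)) = k
      then \<Prod>B\<in>?O. lsubst_pow (card B) (weight C (g B)) else 0)"
    by (auto simp: fps_sum_nth A_def prod_fps_const_X_power intro!: sum.cong)
  also have "\<dots> = fps_nth (coloring_zeta V C) k"
    unfolding fps_nth_coloring_zeta[OF k]
    by (rule sum.inter_filter[symmetric])
      (intro finite_PiE finite_closed_points[OF V] finite_colors_le[OF C])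
  finally show ?thesis by simp
qed

end

section \<open>Infinite products\<close>

lemma laurent_supp_common_bound:
  assumes "finite A" "\<And>a. a \<in> A \<Longrightarrow> laurent_supp (f a)"
  shows "\<exists>c::nat. \<forall>a\<in>A. \<forall>m. f a m \<noteq> 0 \<longrightarrow> (\<forall>i. - int c \<le> m $ i)"
proof -
  have "\<exists>c::nat. \<forall>m. f a m \<noteq> 0 \<longrightarrow> (\<forall>i. - int c \<le> m $ i)" if a: "a \<in> A" for a
  proof -
    obtain b where b: "\<And>m i. f a m \<noteq> 0 \<Longrightarrow> b \<le> m $ i"
      using assms(2)[OF a] unfolding laurent_supp_def by metis
    have "- int (nat (- b)) \<le> b" by simp
    then show ?thesis using b by (meson order_trans)
  qed
  then obtain c where c: "\<And>a m i. a \<in> A \<Longrightarrow> f a m \<noteq> 0 \<Longrightarrow> - int (c a) \<le> m $ i" by metis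
  have "- int (\<Sum>a\<in>A. c a) \<le> - int (c a)" if "a \<in> A" for a
    using member_le_sum[OF that, of c] assms(1) by (simp del: of_nat_sum)
  then show ?thesis using c by (meson order_trans)
qed

text \<open>
  With a common bound on the supports, only finitely many coefficients have to be compared, so
  convergence of each of them suffices.
\<close>
lemma has_formal_prod_lapprox:
  fixes P :: "'n::finite laurent fps"
  assumes P: "has_formal_prod f I P" and bP: "lbounded c n P" and bf: "\<And>i. i \<in> I \<Longrightarrow> lbounded c n (f i)"
  shows "\<forall>\<^sub>F S in finite_subsets_at_top I. lapprox c n L (\<Prod>i\<in>S. f i) P"
proof -
  define E where "E = (SIGMA k:{..n}. {m :: int ^ 'n. \<forall>i. - int (c * k) \<le> m $ i \<and> m $ i \<le> (\<chi> i. int L) $ i})"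
  have fin: "finite E" unfolding E_def by (intro finite_SigmaI finite_int_box) simp
  have "\<forall>\<^sub>F S in finite_subsets_at_top I. \<forall>(k, m)\<in>E.
      lcoeff (fps_nth (\<Prod>i\<in>S. f i) k) m = lcoeff (fps_nth P k) m"
    using P fin by (intro eventually_ball_finite) (auto simp: has_formal_prod_def)
  moreover have "\<forall>\<^sub>F S in finite_subsets_at_top I. S \<subseteq> I"
    by (rule eventually_finite_subsets_at_top_weakI)
  ultimately show ?thesis
  proof eventually_elim
    case (elim S)
    have b: "lbounded c n (\<Prod>i\<in>S. f i)"
      using lapprox_prod[of S c n 0 f f] bf elim(2) by (auto simp: lapprox_refl)
    have "lcoeff (fps_nth (\<Prod>i\<in>S. f i) k) m = lcoeff (fps_nth P k) m"
      if k: "k \<le> n" and m: "\<forall>i. m $ i + int (c * k) \<le> int L" for k m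
    proof (cases "\<forall>i. - int (c * k) \<le> m $ i")
      case True
      have "m $ i \<le> int L" for i using m[rule_format, of i] by linarith
      with True k have "(k, m) \<in> E" by (simp add: E_def)
      then show ?thesis using elim(1) by blast
    next
      case False
      then show ?thesis using lboundedD[OF b k] lboundedD[OF bP k] by metis
    qed
    with b bP show ?case by (simp add: lapprox_def)
  qed
qed

lemma lbounded_coloring_zeta_point:
  assumes C: "valid_coloring_data C"
    and c: "\<And>a m i. cdeg C a \<le> n \<Longrightarrow> lcoeff (weight C a) m \<noteq> 0 \<Longrightarrow> - int c \<le> m $ i"
  shows "lbounded c n (coloring_zeta (point_variety :: ('k::finite_field, unit) atlas) C)"
  unfolding lbounded_def
proof (intro allI impI)
  let ?P = "coloring_zeta (point_variety :: ('k, unit) atlas) C"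
  fix k m i assume k: "k \<le> n" and nz: "lcoeff (fps_nth ?P k) m \<noteq> 0"
  have P: "fps_nth ?P k = (\<Sum>a | cdeg C a = k. weight C a)"
    by (simp add: coloring_zeta_point[OF C])
  show "- int (c * k) \<le> m $ i"
  proof (cases "k = 0")
    case True
    have "fps_nth ?P 0 = 1"
      using C by (simp add: coloring_zeta_point[OF C] valid_coloring_data_def)
    with nz True have "m = 0" by (simp add: one_laurent.rep_eq split: if_splits)
    with True show ?thesis by simp
  next
    case False
    have "(\<Sum>a | cdeg C a = k. lcoeff (weight C a) m) \<noteq> 0" using nz by (simp add: P lcoeff_sum)
    then obtain a where "cdeg C a = k" "lcoeff (weight C a) m \<noteq> 0"
      by (metis (mono_tags, lifting) mem_Collect_eq sum.neutral)
    with c k have "- int c \<le> m $ i" by blast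
    moreover have "int c \<le> int (c * k)" using False by (cases k) auto
    ultimately show ?thesis by linarith
  qed
qed

text \<open>The coefficients of \<open>Z(V, t\<^sup>m T\<^sup>d)\<close> up to \<open>T\<^sup>n\<close> are those of the Euler product over the closed
  points of degree at most \<open>n\<close>.\<close>
lemma lapprox_int_zeta:
  fixes V :: "('k::finite_field, 'p) atlas" and m :: "int ^ 'n::finite"
  assumes V: "variety V" and d: "0 < d" and b: "lbounded c n (tT d m)"
  shows "lapprox c n L (\<Prod>B\<in>closed_points V n. fps_right_inverse (1 - tT d m ^ card B) 1)
           (of_int_fps (int_zeta V) oo tT d m)"
proof -
  let ?h = "fps_dilate d (\<lambda>k a. of_int a * lmonom m ^ k)"
  interpret graded_hom "\<lambda>k a. of_int a * lmonom m ^ k" by (rule graded_hom_of_int_lmonom)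
  have eu: "?h (euler_product V n) = (\<Prod>B\<in>closed_points V n. fps_right_inverse (1 - tT d m ^ card B) 1)"
    unfolding euler_product_def dilate_prod[OF d]
  proof (rule prod.cong)
    fix B assume "B \<in> closed_points V n"
    then have "0 < card B" by (rule closed_point_card_pos[OF V])
    then show "?h (fps_right_inverse (1 - fps_X ^ card B) 1) = fps_right_inverse (1 - tT d m ^ card B) 1"
      by (subst dilate_right_inverse[OF d]) (simp_all add: dilate_diff dilate_one[OF d] dilate_X_power[OF d])
  qed simp
  have "lapprox c n 0 (?h (euler_product V n)) (?h (euler_product V n))"
    unfolding eu
  proof (rule lapprox_prod)
    fix B assume "B \<in> closed_points V n"
    then have pos: "0 < card B" by (rule closed_point_card_pos[OF V])
    have "lapprox c n 0 (tT d m ^ card B) (tT d m ^ card B)"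
      using b by (intro lapprox_power) (simp add: lapprox_refl)
    then have "lbounded c n (1 - tT d m ^ card B)"
      by (intro lbounded_diff lbounded_one) (simp add: lapprox_refl)
    then show "lapprox c n 0 (fps_right_inverse (1 - tT d m ^ card B) 1) (fps_right_inverse (1 - tT d m ^ card B) 1)"
      using fps_nth_0_one_minus_tT[OF pos d, of m] by (intro lapprox_right_inverse) (simp_all add: lapprox_refl)
  qed
  then have "lapprox c n L (?h (euler_product V n)) (?h (int_zeta V))"
    using int_zeta_eq_euler_product[OF V le_trans[OF div_le_dividend]]
    by (intro lapprox_eq_fps) (auto simp: lapprox_refl fps_nth_dilate)
  then show ?thesis by (simp add: eu of_int_fps_compose_tT[OF d])
qed

theorem theorem2:
  fixes V :: "('k::finite_field, 'p) atlas"
    and C :: "('c, 'n::finite) coloring_data"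
    and v :: "nat \<Rightarrow> int ^ 'n \<Rightarrow> int"
  assumes "variety V"
    and "valid_coloring_data C"
    and "\<And>d. d \<ge> 1 \<Longrightarrow> laurent_supp (v d)"
    and "has_formal_prod (\<lambda>(d, m). fps_zpow (1 - tT d m) (- v d m)) ({1..} \<times> UNIV)
           (coloring_zeta (point_variety :: ('k, unit) atlas) C)"
  shows "\<exists>Z :: int fps. of_int_fps Z = zeta V \<and>
           has_formal_prod (\<lambda>(d, m). fps_zpow (fps_compose (of_int_fps Z) (tT d m)) (v d m))
             ({1..} \<times> UNIV) (coloring_zeta V C)"
proof (intro exI conjI)
  note V = assms(1) and C = assms(2)
  let ?P = "coloring_zeta (point_variety :: ('k, unit) atlas) C"
  let ?I = "{1..} \<times> UNIV :: (nat \<times> (int ^ 'n)) set"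
  show "of_int_fps (int_zeta V) = zeta V" by (rule of_int_fps_int_zeta[OF V])
  show "has_formal_prod (\<lambda>(d, m). fps_zpow (of_int_fps (int_zeta V) oo tT d m) (v d m)) ?I (coloring_zeta V C)"
    unfolding has_formal_prod_def
  proof (intro allI)
    fix n and m\<^sub>0 :: "int ^ 'n"
    let ?O = "closed_points V n"
    obtain c\<^sub>1 :: nat where c1: "\<And>d m i. d \<in> {1..n} \<Longrightarrow> v d m \<noteq> 0 \<Longrightarrow> - int c\<^sub>1 \<le> m $ i"
      using laurent_supp_common_bound[of "{1..n}" v] assms(3)
      by (metis atLeastAtMost_iff finite_atLeastAtMost)
    obtain c\<^sub>2 :: nat where c2: "\<And>a m i. a \<in> {a. cdeg C a \<le> n} \<Longrightarrow> lcoeff (weight C a) m \<noteq> 0 \<Longrightarrow> - int c\<^sub>2 \<le> m $ i"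
      using laurent_supp_common_bound[of "{a. cdeg C a \<le> n}" "\<lambda>a. lcoeff (weight C a)"]
        finite_colors_le[OF C] laurent_supp_lcoeff by blast
    \<comment> \<open>Only factors and colors of degree \<open>\<le> n\<close> affect \<open>T\<^sup>n\<close>; their exponents have a common lower bound.\<close>
    define c where "c = max c\<^sub>1 c\<^sub>2"
    \<comment> \<open>Large enough for the coefficient of \<open>t\<close> to the power \<open>m\<^sub>0\<close> in that of \<open>T\<^sup>n\<close> to be compared.\<close>
    define L where "L = (\<Sum>i\<in>UNIV. nat (m\<^sub>0 $ i + int (c * n)))"
    have L: "m\<^sub>0 $ i + int (c * n) \<le> int L" for i
    proof -
      have "nat (m\<^sub>0 $ i + int (c * n)) \<le> L" unfolding L_def by (rule member_le_sum) auto
      then show ?thesis by linarith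
    qed
    have bP: "lbounded c n ?P"
    proof (rule lbounded_coloring_zeta_point[OF C])
      fix a m i assume "cdeg C a \<le> n" "lcoeff (weight C a) m \<noteq> 0"
      then have "- int c\<^sub>2 \<le> m $ i" using c2 by blast
      then show "- int c \<le> m $ i" by (simp add: c_def)
    qed
    have btT: "lbounded c n (tT d m)" if "1 \<le> d" "v d m \<noteq> 0" for d m
    proof (rule lbounded_tT)
      assume "d \<le> n"
      then have "- int c\<^sub>1 \<le> m $ i" for i using c1 that by simp
      moreover have "- int c \<le> - int c\<^sub>1" by (simp add: c_def)
      ultimately show "\<forall>i. - int c \<le> m $ i" by (meson order_trans)
    qed (use that in simp)
    have bf: "lbounded c n (case i of (d, m) \<Rightarrow> fps_zpow (1 - tT d m) (- v d m))" if i: "i \<in> ?I" for i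
    proof -
      obtain d m where dm: "i = (d, m)" "1 \<le> d" using i by auto
      show ?thesis
      proof (cases "v d m = 0")
        case False
        have "lapprox c n 0 (1 - tT d m) (1 - tT d m)"
          using btT[OF dm(2) False] by (simp add: lapprox_refl lbounded_diff lbounded_one)
        from lapprox_zpow[OF this] show ?thesis
          using dm fps_nth_0_one_minus_tT[of 1 d m] by (simp add: lapprox_refl)
      qed (simp add: dm lbounded_one)
    qed
    have coeff: "lapprox c n L (coloring_zeta V C) (\<Prod>B\<in>?O. fps_dilate (card B) (\<lambda>_. lsubst_pow (card B)) ?P)"
    proof (rule lapprox_sym, rule lapprox_eq_fps)
      have "lapprox c n 0 (\<Prod>B\<in>?O. fps_dilate (card B) (\<lambda>_. lsubst_pow (card B)) ?P)
          (\<Prod>B\<in>?O. fps_dilate (card B) (\<lambda>_. lsubst_pow (card B)) ?P)"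
        using bP closed_point_card_pos[OF V]
        by (intro lapprox_prod lapprox_dilate_lsubst) (auto simp: lapprox_refl)
      then show "lbounded c n (\<Prod>B\<in>?O. fps_dilate (card B) (\<lambda>_. lsubst_pow (card B)) ?P)"
        by (simp add: lapprox_refl)
    qed (simp add: coloring_zeta_euler_product[OF V C])
    have "\<forall>\<^sub>F S in finite_subsets_at_top ?I. lapprox c n L (\<Prod>(d, m)\<in>S. fps_zpow (1 - tT d m) (- v d m)) ?P"
      by (rule has_formal_prod_lapprox[OF assms(4) bP bf])
    moreover have "\<forall>\<^sub>F S in finite_subsets_at_top ?I. S \<subseteq> ?I"
      by (rule eventually_finite_subsets_at_top_weakI)
    ultimately show "\<forall>\<^sub>F S in finite_subsets_at_top ?I.
        lcoeff (fps_nth (\<Prod>(d, m)\<in>S. fps_zpow (of_int_fps (int_zeta V) oo tT d m) (v d m)) n) m\<^sub>0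
          = lcoeff (fps_nth (coloring_zeta V C) n) m\<^sub>0"
    proof eventually_elim
      case (elim S)
      have dpos: "0 < d" if "(d, m) \<in> S" for d m using elim(2) that by auto
      have dil: "fps_dilate (card B) (\<lambda>_. lsubst_pow (card B)) (\<Prod>(d, m)\<in>S. fps_zpow (1 - tT d m) (- v d m))
          = (\<Prod>(d, m)\<in>S. fps_zpow (1 - tT d m ^ card B) (- v d m))" if B: "B \<in> ?O" for B
      proof -
        have pos: "0 < card B" using closed_point_card_pos[OF V B] .
        interpret graded_hom "\<lambda>_. lsubst_pow (card B)" by (rule graded_hom_lsubst_pow[OF pos])
        show ?thesis
          unfolding dilate_prod[OF pos]
        proof (rule prod.cong, safe)
          fix d m assume dm: "(d, m) \<in> S"
          have "fps_nth (1 - tT d m) 0 = 1" using fps_nth_0_one_minus_tT[of 1 d m] dpos[OF dm] by simp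
          then show "fps_dilate (card B) (\<lambda>_. lsubst_pow (card B)) (fps_zpow (1 - tT d m) (- v d m))
              = fps_zpow (1 - tT d m ^ card B) (- v d m)"
            by (simp add: dilate_zpow[OF pos] dilate_diff dilate_one[OF pos] dilate_lsubst_tT[OF pos])
        qed
      qed
      have "lapprox c n L (coloring_zeta V C) (\<Prod>B\<in>?O. fps_dilate (card B) (\<lambda>_. lsubst_pow (card B)) ?P)"
        by (rule coeff)
      also have "lapprox c n L \<dots> (\<Prod>B\<in>?O. \<Prod>(d, m)\<in>S. fps_zpow (1 - tT d m ^ card B) (- v d m))"
      proof (rule lapprox_prod)
        fix B assume B: "B \<in> ?O"
        show "lapprox c n L (fps_dilate (card B) (\<lambda>_. lsubst_pow (card B)) ?P)
            (\<Prod>(d, m)\<in>S. fps_zpow (1 - tT d m ^ card B) (- v d m))"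
          using lapprox_dilate_lsubst[OF lapprox_sym[OF elim(1)] closed_point_card_pos[OF V B]]
          by (simp add: dil[OF B])
      qed
      also have "(\<Prod>B\<in>?O. \<Prod>(d, m)\<in>S. fps_zpow (1 - tT d m ^ card B) (- v d m))
          = (\<Prod>(d, m)\<in>S. \<Prod>B\<in>?O. fps_zpow (1 - tT d m ^ card B) (- v d m))"
        by (subst prod.swap) (simp add: case_prod_unfold)
      also have "lapprox c n L \<dots> (\<Prod>(d, m)\<in>S. fps_zpow (of_int_fps (int_zeta V) oo tT d m) (v d m))"
      proof (rule lapprox_prod, clarify)
        fix d m assume dm: "(d, m) \<in> S"
        have d: "0 < d" using dpos[OF dm] .
        have one: "fps_nth (1 - tT d m ^ card B) 0 = 1" if "B \<in> ?O" for B
          using fps_nth_0_one_minus_tT[OF closed_point_card_pos[OF V that] d] .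
        let ?E = "\<Prod>B\<in>?O. fps_right_inverse (1 - tT d m ^ card B) 1"
        have "(\<Prod>B\<in>?O. fps_zpow (1 - tT d m ^ card B) (- v d m))
            = (\<Prod>B\<in>?O. fps_zpow (fps_right_inverse (1 - tT d m ^ card B) 1) (v d m))"
          by (rule prod.cong) (simp_all only: fps_zpow_right_inverse[OF one])
        also have "\<dots> = fps_zpow ?E (v d m)" by (subst fps_zpow_prod) simp_all
        finally have *: "(\<Prod>B\<in>?O. fps_zpow (1 - tT d m ^ card B) (- v d m)) = fps_zpow ?E (v d m)" .
        show "lapprox c n L (\<Prod>B\<in>?O. fps_zpow (1 - tT d m ^ card B) (- v d m))
            (fps_zpow (of_int_fps (int_zeta V) oo tT d m) (v d m))"
        \<comment> \<open>If \<open>v d m = 0\<close>, there is no bound on \<open>m\<close>, but then both sides are \<open>1\<close>.\<close>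
        proof (cases "v d m = 0")
          case True
          then show ?thesis by (simp add: lapprox_one)
        next
          case False
          have Z0: "fps_nth (int_zeta V) 0 = 1"
            unfolding int_zeta_eq_euler_product[OF V le0[of n]] euler_product_def
            by (rule fps_nth_0_prod_1) simp
          show ?thesis
            unfolding *
            using lapprox_int_zeta[OF V d btT[OF _ False], of L] d
            by (intro lapprox_zpow fps_nth_0_prod_1) (simp_all add: of_int_fps_def Z0)
        qed
      qed
      finally have "lapprox c n L (coloring_zeta V C)
          (\<Prod>(d, m)\<in>S. fps_zpow (of_int_fps (int_zeta V) oo tT d m) (v d m))" .
      then show ?case using L by (simp add: lapprox_def)
    qed
  qed
qed

end
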